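(* Let $k=k(n)$ satisfy $k=O(\log n/\log\log n)$. Then $Q^{a}(\mathrm{Lin}_{k})=\Theta(k\log n)$ and $Q^{p}(\mathrm{Lin}_{k})=\Theta(k\log n)$; that is, both active and passive testing of $k$-linear Boolean functions on $n$ variables require, and can be done with, $\Theta(k\log n)$ queries.
   Context: Boolean functions are maps $f:\mathbb{Z}_2^n\to\mathbb{Z}_2$. For a family $\mathcal{P}$ of Boolean functions, $f$ is $\epsilon$-far from $\mathcal{P}$ if $|\{x: f(x)\ne g(x)\}|\ge \epsilon 2^n$ for every $g\in\mathcal{P}$. A $u$-sample $q$-query $\epsilon$-tester for $\mathcal{P}$ is a randomized algorithm that, given a set $U\subseteq\mathbb{Z}_2^n$ of $u$ points drawn uniformly at random, queries an unknown $f$ on $q$ inputs from $U$, accepts with probability at least $2/3$ when $f\in\mathcal{P}$ and rejects with probability at least $2/3$ when $f$ is $\epsilon$-far from $\mathcal{P}$. $Q^a_\epsilon(\mathcal{P},u)$ is the minimal such $q$; $Q^a(\mathcal{P})$ denotes this with a sample size $u=\mathrm{poly}(n)$ (active testing). $Q^p_\epsilon(\mathcal{P})$ is the minimal $q$ for which a $q$-sample $q$-query $\epsilon$-tester exists (passive testing). Throughout $\epsilon$ is a fixed small constant (e.g. $0.001$), omitted from notation, and asymptotics are as $n\to\infty$. $\mathrm{Lin}_k$ is the family of functions $f(x)=x_{i_1}+\cdots+x_{i_k}$ (sum over $\mathbb{Z}_2$) for distinct $i_1,\dots,i_k\in[n]$. Logarithms are base 2. *)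

theory Defs
  imports
    "HOL-Probability.Probability"
    "HOL-Library.Landau_Symbols"
    "HOL-Library.Z2"
begin

type_synonym point = "nat \<Rightarrow> bit"
type_synonym boolean_function = "point \<Rightarrow> bit"

text \<open>
  The points of $\mathbb{Z}_2^n$ are extensional functions on the index set \<open>{..<n}\<close>, and Boolean
  functions on $\mathbb{Z}_2^n$ are extensional functions on these points.
\<close>

definition cube :: "nat \<Rightarrow> point set" where
  "cube n = {..<n} \<rightarrow>\<^sub>E UNIV"

definition boolean_functions :: "nat \<Rightarrow> boolean_function set" where
  "boolean_functions n = cube n \<rightarrow>\<^sub>E UNIV"

definition Lin :: "nat \<Rightarrow> nat \<Rightarrow> boolean_function set" where
  "Lin n k = {restrict (\<lambda>x. \<Sum>i\<in>I. x i) (cube n) | I. I \<subseteq> {..<n} \<and> card I = k}"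

definition far :: "nat \<Rightarrow> real \<Rightarrow> boolean_function set \<Rightarrow> boolean_function \<Rightarrow> bool" where
  "far n \<epsilon> P f \<longleftrightarrow> (\<forall>g\<in>P. real (card {x \<in> cube n. f x \<noteq> g x}) \<ge> \<epsilon> * 2 ^ n)"

text \<open>
  A deterministic query algorithm is a decision tree: it either stops with a verdict
  (\<open>True\<close> = accept) or queries a point and continues depending on the reply, so queries may
  be adaptive. A randomized algorithm is a distribution over such trees; as there are only
  finitely many trees of bounded depth with queries from a given finite set, discrete
  distributions are fully general.
\<close>

datatype strategy = Verdict bool | Query point "bit \<Rightarrow> strategy"

primrec accepts :: "boolean_function \<Rightarrow> strategy \<Rightarrow> bool" where
  "accepts f (Verdict b) = b"
| "accepts f (Query x t) = accepts f (t (f x))"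

primrec queried :: "strategy \<Rightarrow> point set" where
  "queried (Verdict b) = {}"
| "queried (Query x t) = insert x (\<Union>r. queried (t r))"

text \<open>The maximal number of queries made along any sequence of replies.\<close>

primrec query_count :: "strategy \<Rightarrow> nat" where
  "query_count (Verdict b) = 0"
| "query_count (Query x t) = Suc (max (query_count (t 0)) (query_count (t 1)))"

definition samples :: "nat \<Rightarrow> nat \<Rightarrow> point set set" where
  "samples n u = {U. U \<subseteq> cube n \<and> card U = u}"

text \<open>
  The strategy that is eventually run, jointly random in the uniformly drawn sample
  and in the coins of the algorithm \<open>A\<close>. It is meaningful only for \<open>u \<le> 2 ^ n\<close>, since
  otherwise there is no sample of size \<open>u\<close>.
\<close>

definition run :: "nat \<Rightarrow> nat \<Rightarrow> (point set \<Rightarrow> strategy pmf) \<Rightarrow> strategy pmf" where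
  "run n u A = bind_pmf (pmf_of_set (samples n u)) A"

definition is_tester ::
  "nat \<Rightarrow> boolean_function set \<Rightarrow> real \<Rightarrow> nat \<Rightarrow> nat \<Rightarrow> (point set \<Rightarrow> strategy pmf) \<Rightarrow> bool" where
  "is_tester n P \<epsilon> u q A \<longleftrightarrow>
     u \<le> 2 ^ n \<and>
     (\<forall>U\<in>samples n u. \<forall>t\<in>set_pmf (A U). queried t \<subseteq> U \<and> query_count t \<le> q) \<and>
     (\<forall>f\<in>P. measure_pmf.prob (run n u A) {t. accepts f t} \<ge> 2 / 3) \<and>
     (\<forall>f\<in>boolean_functions n. far n \<epsilon> P f \<longrightarrow>
        measure_pmf.prob (run n u A) {t. \<not> accepts f t} \<ge> 2 / 3)"

text \<open>
  If there is no tester at all, \<open>min_or_0\<close> yields \<open>0\<close>; so a positive lower bound on the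
  query complexities below entails that testers exist.
\<close>

definition min_or_0 :: "nat set \<Rightarrow> nat" where
  "min_or_0 S = (if S = {} then 0 else LEAST q. q \<in> S)"

definition Q_active :: "real \<Rightarrow> nat \<Rightarrow> boolean_function set \<Rightarrow> nat \<Rightarrow> nat" where
  "Q_active \<epsilon> n P u = min_or_0 {q. \<exists>A. is_tester n P \<epsilon> u q A}"

definition Q_passive :: "real \<Rightarrow> nat \<Rightarrow> boolean_function set \<Rightarrow> nat" where
  "Q_passive \<epsilon> n P = min_or_0 {q. \<exists>A. is_tester n P \<epsilon> q q A}"

text \<open>
  Sample sizes $\mathrm{poly}(n)$ are read as $n^{\Theta(1)}$: if the sample were smaller than every
  positive power of \<open>n\<close> (e.g. constant), a tester need not exist.
\<close>

definition poly_size :: "(nat \<Rightarrow> nat) \<Rightarrow> bool" where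
  "poly_size u \<longleftrightarrow>
     (\<exists>a b. 0 < a \<and> (\<forall>\<^sub>F n in sequentially. real n powr a \<le> real (u n) \<and> real (u n) \<le> real n powr b))"

end

theory Submission
  imports Defs "HOL-Real_Asymp.Real_Asymp"
begin

text \<open>
  Upper bound: an $\epsilon$-far function agrees with a fixed $k$-linear function on $q$ random points
  with probability at most $(1-\epsilon)^q$. As there are at most $n^k$ such functions,
  $q = O(k \log n)$ sample points suffice to accept exactly the functions consistent with
  $\mathrm{Lin}_k$ on the sample. In the active model this is run on a random subset of the sample.

  Lower bound: split the coordinates into $k$ blocks of size $m \approx n/k$ and choose one coordinate
  of each block at random. By Hoeffding's inequality and a union bound over the $u^q$ small
  subsets of the sample, with high probability every nonempty set $S$ of at most $q$ sample points
  satisfies $|\sum_{i \in B} \prod_{x \in S} (-1)^{x_i}| \le m^{3/4}$ for every block $B$. Fourier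
  inversion on a query set $Q$ then shows that each answer pattern has probability at least
  $2^{-|Q|}(1 - 2^q m^{-k/4})$, which is $(1-o(1)) 2^{-|Q|}$ for $q \le (k \log n)/16$. So the
  tester rejects this $k$-linear function almost as often as a uniformly random function, which is
  far from $\mathrm{Lin}_k$ with high probability.
\<close>

section \<open>Finiteness and size of the cube, of function spaces and of sample spaces\<close>

lemma UNIV_bit: "(UNIV :: bit set) = {0, 1}"
  using bit.exhaust by auto

lemma finite_cube [simp]: "finite (cube n)"
  unfolding cube_def by (rule finite_PiE) (auto simp: UNIV_bit)

lemma card_cube: "card (cube n) = 2 ^ n"
  unfolding cube_def by (simp add: card_funcsetE UNIV_bit numeral_2_eq_2)

lemma finite_boolean_functions [simp]: "finite (boolean_functions n)"
  unfolding boolean_functions_def by (rule finite_PiE) (auto simp: UNIV_bit)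

lemma boolean_functions_nonempty [simp]: "boolean_functions n \<noteq> {}"
  unfolding boolean_functions_def by (simp add: PiE_eq_empty_iff)

lemma finite_samples [simp]: "finite (samples n u)"
  unfolding samples_def by (rule finite_subset[of _ "Pow (cube n)"]) auto

lemma card_samples: "card (samples n u) = 2 ^ n choose u"
  unfolding samples_def by (simp add: n_subsets card_cube)

lemma samples_nonempty: "u \<le> 2 ^ n \<Longrightarrow> samples n u \<noteq> {}"
  using card_samples[of n u] zero_less_binomial[of u "2 ^ n"] by force

text \<open>The nontrivial character of Z_2. It turns sums over Z_2 into real products, which makes
  Fourier expansion available.\<close>

definition bit_sign :: "bit \<Rightarrow> real" where
  "bit_sign b = (if b = 0 then 1 else -1)"

lemma bit_sign_simps [simp]: "bit_sign 0 = 1" "bit_sign 1 = -1" "\<bar>bit_sign b\<bar> = 1"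
  by (simp_all add: bit_sign_def)

lemma bit_sign_add: "bit_sign (a + b) = bit_sign a * bit_sign b"
  by (cases a; cases b) (simp_all add: bit_sign_def)

lemma bit_sign_sum: "bit_sign (\<Sum>i\<in>A. f i) = (\<Prod>i\<in>A. bit_sign (f i))"
  by (induction A rule: infinite_finite_induct) (simp_all add: bit_sign_add del: add_bit_eq_xor)

lemma bit_sign_agree: "1 + bit_sign a * bit_sign b = (if a = b then 2 else 0)"
  by (cases a; cases b) (simp_all add: bit_sign_def)

lemma abs_prod_bit_sign: "\<bar>\<Prod>x\<in>S. bit_sign (f x)\<bar> = 1"
  by (simp add: abs_prod)

section \<open>Counting subsets that contain a given set\<close>

lemma card_supersets:
  assumes "finite X" "S \<subseteq> X" "card S \<le> u"
  shows "card {U. U \<subseteq> X \<and> card U = u \<and> S \<subseteq> U} = (card X - card S) choose (u - card S)"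
proof -
  have fS: "finite S" using assms finite_subset by blast
  have "bij_betw (\<lambda>V. V \<union> S) {V. V \<subseteq> X - S \<and> card V = u - card S} {U. U \<subseteq> X \<and> card U = u \<and> S \<subseteq> U}"
  proof (rule bij_betw_byWitness[where f' = "\<lambda>U. U - S"])
    show "(\<lambda>V. V \<union> S) ` {V. V \<subseteq> X - S \<and> card V = u - card S} \<subseteq> {U. U \<subseteq> X \<and> card U = u \<and> S \<subseteq> U}"
    proof safe
      fix V assume V: "V \<subseteq> X - S" "card V = u - card S"
      have "finite V" using V assms(1) finite_subset by blast
      then have "card (V \<union> S) = card V + card S"
        using V fS by (intro card_Un_disjoint) auto
      then show "card (V \<union> S) = u" using V assms by simp
    qed (use assms in auto)
    show "(\<lambda>U. U - S) ` {U. U \<subseteq> X \<and> card U = u \<and> S \<subseteq> U} \<subseteq> {V. V \<subseteq> X - S \<and> card V = u - card S}"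
      using fS by (auto simp: card_Diff_subset)
  qed auto
  then have "card {U. U \<subseteq> X \<and> card U = u \<and> S \<subseteq> U} = card {V. V \<subseteq> X - S \<and> card V = u - card S}"
    by (simp add: bij_betw_same_card)
  also have "\<dots> = card (X - S) choose (u - card S)"
    using assms by (simp add: n_subsets)
  also have "card (X - S) = card X - card S"
    using assms fS by (simp add: card_Diff_subset)
  finally show ?thesis .
qed

text \<open>Compares sampling without and with replacement: the ratio of the two binomials is the
  product of \<open>(u - i) / (N - i)\<close> over \<open>i < s\<close>, and each factor is at most
  \<open>u / N\<close>. The form without division lets the induction run in \<open>nat\<close> and
  covers large \<open>s\<close>.\<close>

lemma binomial_ratio_le_power:
  assumes "u \<le> N"
  shows "N ^ s * (u choose s) \<le> u ^ s * (N choose s)"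
proof (induction s)
  case (Suc s)
  have step: "Suc s * (M choose Suc s) = (M - s) * (M choose s)" for M
    by (metis binomial_absorb_comp binomial_absorption)
  have a: "N * (u - s) \<le> u * (N - s)"
    using assms by (simp add: diff_mult_distrib2 mult.commute diff_le_mono2)
  have "Suc s * (N ^ Suc s * (u choose Suc s)) = N ^ s * (u choose s) * (N * (u - s))"
    by (simp only: power_Suc step mult.left_commute[of "Suc s"]) (simp only: ac_simps)
  also have "\<dots> \<le> u ^ s * (N choose s) * (u * (N - s))"
    by (intro mult_le_mono Suc a)
  also have "\<dots> = Suc s * (u ^ Suc s * (N choose Suc s))"
    by (simp only: power_Suc step mult.left_commute[of "Suc s"]) (simp only: ac_simps)
  finally show ?case by (simp only: mult_le_cancel1 zero_less_Suc)
qed simp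

section \<open>Hoeffding's inequality for sums of random signs\<close>

lemma cosh_le_exp_half_square:
  fixes x :: real
  assumes "x \<ge> 0"
  shows "cosh x \<le> exp (x\<^sup>2 / 2)"
proof -
  \<comment> \<open>The case of probability 1/2 and range \<open>2 * x\<close> of the estimate
    behind Hoeffding's lemma. It applies to cosh because
    \<open>(1 + exp (2 * x)) / 2 = exp x * cosh x\<close>.\<close>
  have "- (2 * x) * (1 / 2) + ln (1 + 1 / 2 * (exp (2 * x) - 1)) \<le> (2 * x)\<^sup>2 / 8"
    by (rule Hoeffdings_lemma_aux) (use assms in auto)
  then have "ln (1 + 1 / 2 * (exp (2 * x) - 1)) \<le> x + x\<^sup>2 / 2"
    by (simp add: power_mult_distrib)
  moreover have "1 + 1 / 2 * (exp (2 * x) - 1) > (0::real)"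
    by (simp add: add_pos_pos field_simps)
  ultimately have "1 + 1 / 2 * (exp (2 * x) - 1) \<le> exp x * exp (x\<^sup>2 / 2)"
    by (metis exp_add exp_le_cancel_iff exp_ln)
  moreover have "1 + 1 / 2 * (exp (2 * x) - 1) = exp x * cosh x"
    by (simp add: cosh_field_def field_simps flip: exp_add)
  ultimately show ?thesis by simp
qed

text \<open>Chernoff's method in counting form: the sum of \<open>exp (\<theta> * ?s x)\<close> over
  the cube factors over coordinates, with factor \<open>2 * cosh \<theta>\<close> on
  \<open>J\<close> and 2 elsewhere.\<close>

lemma signed_sum_tail:
  fixes \<sigma> :: "'a \<Rightarrow> real"
  assumes fin: "finite I" and J: "J \<subseteq> I" "J \<noteq> {}" and \<sigma>: "\<And>i. i \<in> J \<Longrightarrow> \<bar>\<sigma> i\<bar> = 1" and t: "t \<ge> 0"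
  shows "real (card {x \<in> I \<rightarrow>\<^sub>E UNIV. (\<Sum>i\<in>J. \<sigma> i * bit_sign (x i)) \<ge> t})
           \<le> 2 ^ card I * exp (- t\<^sup>2 / (2 * card J))"
proof -
  \<comment> \<open>The minimiser of the exponent
    \<open>\<theta>^2 * card J / 2 - \<theta> * t\<close> obtained below.\<close>
  define \<theta> where "\<theta> = t / card J"
  have fJ: "finite J" and cJ: "card J > 0"
    using fin J finite_subset by (auto simp: card_gt_0_iff)
  have \<theta>: "\<theta> \<ge> 0" unfolding \<theta>_def using t by simp
  let ?X = "I \<rightarrow>\<^sub>E (UNIV :: bit set)"
  let ?s = "\<lambda>x. \<Sum>i\<in>J. \<sigma> i * bit_sign (x i)"
  have finX: "finite ?X" using fin by (intro finite_PiE) (auto simp: UNIV_bit)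
  have factor: "(\<Sum>b\<in>UNIV. if i \<in> J then exp (\<theta> * (\<sigma> i * bit_sign b)) else 1)
      = (if i \<in> J then 2 * cosh \<theta> else 2)" for i
  proof (cases "i \<in> J")
    case True
    then have "\<sigma> i = 1 \<or> \<sigma> i = -1" using \<sigma>[of i] by linarith
    then show ?thesis using True by (auto simp: UNIV_bit cosh_field_def)
  qed (simp add: UNIV_bit)
  have "real (card {x \<in> ?X. ?s x \<ge> t}) * exp (\<theta> * t) = (\<Sum>x\<in>{x \<in> ?X. ?s x \<ge> t}. exp (\<theta> * t))"
    by simp
  also have "\<dots> \<le> (\<Sum>x\<in>{x \<in> ?X. ?s x \<ge> t}. exp (\<theta> * ?s x))"
    using \<theta> by (intro sum_mono) (auto intro: mult_left_mono)
  also have "\<dots> \<le> (\<Sum>x\<in>?X. exp (\<theta> * ?s x))"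
    using finX by (intro sum_mono2) auto
  also have "\<dots> = (\<Sum>x\<in>?X. \<Prod>i\<in>I. if i \<in> J then exp (\<theta> * (\<sigma> i * bit_sign (x i))) else 1)"
  proof (rule sum.cong[OF refl])
    fix x
    have "exp (\<theta> * ?s x) = (\<Prod>i\<in>J. exp (\<theta> * (\<sigma> i * bit_sign (x i))))"
      using fJ by (simp add: sum_distrib_left exp_sum)
    also have "\<dots> = (\<Prod>i\<in>I. if i \<in> J then exp (\<theta> * (\<sigma> i * bit_sign (x i))) else 1)"
      using fin J by (simp add: prod.If_cases Int_absorb1)
    finally show "exp (\<theta> * ?s x) = \<dots>" .
  qed
  also have "\<dots> = (\<Prod>i\<in>I. if i \<in> J then 2 * cosh \<theta> else 2)"
    using fin by (subst prod_sum_PiE [symmetric]) (simp_all add: UNIV_bit flip: factor)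
  also have "\<dots> = (\<Prod>i\<in>I. 2 * (if i \<in> J then cosh \<theta> else 1))"
    by (intro prod.cong) auto
  also have "\<dots> = 2 ^ card I * cosh \<theta> ^ card J"
    using fin J by (simp add: prod.distrib prod.If_cases Int_absorb1)
  also have "\<dots> \<le> 2 ^ card I * exp (\<theta>\<^sup>2 / 2) ^ card J"
    using cosh_le_exp_half_square[OF \<theta>] by (intro mult_left_mono power_mono) auto
  finally have "real (card {x \<in> ?X. ?s x \<ge> t}) \<le> 2 ^ card I * (exp (\<theta>\<^sup>2 / 2) ^ card J * exp (- (\<theta> * t)))"
    by (simp add: exp_minus field_simps)
  also have "exp (\<theta>\<^sup>2 / 2) ^ card J * exp (- (\<theta> * t)) = exp (- t\<^sup>2 / (2 * card J))"
    using cJ by (simp add: \<theta>_def field_simps power2_eq_square flip: exp_of_nat_mult exp_add)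
  finally show ?thesis .
qed

lemma signed_sum_tail_abs:
  fixes \<sigma> :: "'a \<Rightarrow> real"
  assumes fin: "finite I" and J: "J \<subseteq> I" "J \<noteq> {}" and \<sigma>: "\<And>i. i \<in> J \<Longrightarrow> \<bar>\<sigma> i\<bar> = 1" and t: "t \<ge> 0"
  shows "real (card {x \<in> I \<rightarrow>\<^sub>E UNIV. \<bar>\<Sum>i\<in>J. \<sigma> i * bit_sign (x i)\<bar> \<ge> t})
           \<le> 2 * 2 ^ card I * exp (- t\<^sup>2 / (2 * card J))"
proof -
  let ?X = "I \<rightarrow>\<^sub>E (UNIV :: bit set)"
  let ?P = "{x \<in> ?X. (\<Sum>i\<in>J. \<sigma> i * bit_sign (x i)) \<ge> t}"
  let ?M = "{x \<in> ?X. (\<Sum>i\<in>J. - \<sigma> i * bit_sign (x i)) \<ge> t}"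
  have "{x \<in> ?X. \<bar>\<Sum>i\<in>J. \<sigma> i * bit_sign (x i)\<bar> \<ge> t} \<subseteq> ?P \<union> ?M"
    by (auto simp: sum_negf abs_if split: if_splits)
  moreover have "finite ?X" using fin by (intro finite_PiE) (auto simp: UNIV_bit)
  ultimately have "card {x \<in> ?X. \<bar>\<Sum>i\<in>J. \<sigma> i * bit_sign (x i)\<bar> \<ge> t} \<le> card ?P + card ?M"
    by (intro order.trans[OF card_mono card_Un_le]) auto
  moreover have "real (card ?P) \<le> 2 ^ card I * exp (- t\<^sup>2 / (2 * card J))"
    by (rule signed_sum_tail) (use assms in auto)
  moreover have "real (card ?M) \<le> 2 ^ card I * exp (- t\<^sup>2 / (2 * card J))"
    by (rule signed_sum_tail[where \<sigma> = "\<lambda>i. - \<sigma> i"]) (use assms in auto)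
  ultimately show ?thesis by linarith
qed

subsection \<open>Fourier analysis of block parities\<close>

text \<open>
  The indicator of the event is a product of factors $(1 + \chi)/2$; expanding it over subsets
  \<open>S\<close> of \<open>Q\<close> gives the main term for \<open>S = {}\<close>, and every other term factors over the blocks.
\<close>

lemma block_parity_count:
  fixes B :: "nat \<Rightarrow> nat set" and y :: "point \<Rightarrow> bit"
  assumes finB: "\<And>j. j < K \<Longrightarrow> finite (B j) \<and> card (B j) = m"
    and finQ: "finite Q" and l: "0 \<le> l"
    and bal: "\<And>S j. S \<subseteq> Q \<Longrightarrow> S \<noteq> {} \<Longrightarrow> j < K \<Longrightarrow> \<bar>\<Sum>i\<in>B j. \<Prod>x\<in>S. bit_sign (x i)\<bar> \<le> l"
  shows "real m ^ K - 2 ^ card Q * l ^ K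
    \<le> 2 ^ card Q * real (card {i \<in> PiE {..<K} B. \<forall>x\<in>Q. (\<Sum>j<K. x (i j)) = y x})"
proof -
  let ?I = "PiE {..<K} B"
  let ?s = "\<lambda>S. \<Prod>x\<in>S. bit_sign (y x)"
  let ?c = "\<lambda>S. \<Prod>j<K. \<Sum>i\<in>B j. \<Prod>x\<in>S. bit_sign (x i)"
  have finI: "finite ?I" using finB by (intro finite_PiE) auto
  have "2 ^ card Q * real (card {i \<in> ?I. \<forall>x\<in>Q. (\<Sum>j<K. x (i j)) = y x})
      = (\<Sum>i\<in>?I. if \<forall>x\<in>Q. (\<Sum>j<K. x (i j)) = y x then 2 ^ card Q else 0)"
    using finI by (simp add: sum.If_cases Int_def)
  also have "\<dots> = (\<Sum>i\<in>?I. \<Prod>x\<in>Q. bit_sign (y x) * bit_sign (\<Sum>j<K. x (i j)) + 1)"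
  proof (rule sum.cong[OF refl])
    fix i
    have "(\<Prod>x\<in>Q. bit_sign (y x) * bit_sign (\<Sum>j<K. x (i j)) + 1)
        = (\<Prod>x\<in>Q. if (\<Sum>j<K. x (i j)) = y x then 2 else 0)"
      by (subst add.commute, subst bit_sign_agree) (auto intro!: prod.cong)
    also have "\<dots> = (if \<forall>x\<in>Q. (\<Sum>j<K. x (i j)) = y x then 2 ^ card Q else 0)"
      using finQ by (auto simp: prod_zero_iff)
    finally show "(if \<forall>x\<in>Q. (\<Sum>j<K. x (i j)) = y x then 2 ^ card Q else 0)
        = (\<Prod>x\<in>Q. bit_sign (y x) * bit_sign (\<Sum>j<K. x (i j)) + 1)" by simp
  qed
  also have "\<dots> = (\<Sum>i\<in>?I. \<Sum>S\<in>Pow Q. ?s S * (\<Prod>x\<in>S. \<Prod>j<K. bit_sign (x (i j))))"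
    using finQ by (simp add: prod_add prod.distrib bit_sign_sum)
  also have "\<dots> = (\<Sum>S\<in>Pow Q. ?s S * (\<Sum>i\<in>?I. \<Prod>j<K. \<Prod>x\<in>S. bit_sign (x (i j))))"
    by (subst sum.swap, subst prod.swap) (simp add: sum_distrib_left)
  also have "\<dots> = (\<Sum>S\<in>Pow Q. ?s S * ?c S)"
    using finB by (subst prod_sum_PiE) auto
  also have "\<dots> = real m ^ K + (\<Sum>S\<in>Pow Q - {{}}. ?s S * ?c S)"
    using finQ finB by (subst sum.remove[of _ "{}"]) auto
  finally have eq: "2 ^ card Q * real (card {i \<in> ?I. \<forall>x\<in>Q. (\<Sum>j<K. x (i j)) = y x})
      = real m ^ K + (\<Sum>S\<in>Pow Q - {{}}. ?s S * ?c S)" .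
  have "\<bar>\<Sum>S\<in>Pow Q - {{}}. ?s S * ?c S\<bar> \<le> (\<Sum>S\<in>Pow Q - {{}}. l ^ K)"
  proof (rule order.trans[OF sum_abs sum_mono])
    fix S assume S: "S \<in> Pow Q - {{}}"
    have "\<bar>?s S * ?c S\<bar> = (\<Prod>j<K. \<bar>\<Sum>i\<in>B j. \<Prod>x\<in>S. bit_sign (x i)\<bar>)"
      by (simp add: abs_mult abs_prod_bit_sign) (simp add: abs_prod)
    also have "\<dots> \<le> (\<Prod>j<K. l)"
      using S by (intro prod_mono) (auto intro!: bal)
    finally show "\<bar>?s S * ?c S\<bar> \<le> l ^ K" by simp
  qed
  also have "\<dots> \<le> 2 ^ card Q * l ^ K"
    using finQ l by (simp add: card_Diff_singleton_if card_Pow mult_right_mono)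
  finally show ?thesis using eq by linarith
qed

subsection \<open>Adaptive queries\<close>

text \<open>
  Domination only has to be known for answers on fixed query sets: a leaf of an adaptive
  strategy is such a set together with its answers, so it is enough to sum over the leaves.
\<close>

lemma dominated_strategy:
  fixes D E :: "boolean_function pmf"
  assumes c: "\<And>Q y. Q \<subseteq> U \<Longrightarrow> finite Q \<Longrightarrow> card Q \<le> q \<Longrightarrow>
      c * measure_pmf.prob E {f. \<forall>x\<in>Q. f x = y x} \<le> measure_pmf.prob D {f. \<forall>x\<in>Q. f x = y x}"
    and t: "queried t \<subseteq> U" "query_count t \<le> q"
  shows "c * measure_pmf.prob E {f. accepts f t = v} \<le> measure_pmf.prob D {f. accepts f t = v}"
proof -
  define M where "M Q y = {f :: boolean_function. \<forall>x\<in>Q. f x = y x}" for Q y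
  have cM: "c * measure_pmf.prob E (M Q y) \<le> measure_pmf.prob D (M Q y)"
    if "Q \<subseteq> U" "finite Q" "card Q \<le> q" for Q y
    unfolding M_def by (rule c[OF that])
  \<comment> \<open>Generalised for the induction: \<open>M Q y\<close> says that the replies
    recorded so far on the queried set \<open>Q\<close> are those of \<open>y\<close>;
    \<open>card Q\<close> plus the remaining depth stays within \<open>q\<close>.\<close>
  have "Q \<subseteq> U \<Longrightarrow> finite Q \<Longrightarrow> queried t \<subseteq> U \<Longrightarrow> card Q + query_count t \<le> q \<Longrightarrow>
      c * measure_pmf.prob E (M Q y \<inter> {f. accepts f t = v})
        \<le> measure_pmf.prob D (M Q y \<inter> {f. accepts f t = v})" for Q y
  proof (induction t arbitrary: Q y)
    case (Verdict b)
    \<comment> \<open>At a leaf the verdict is fixed, so the event is all of \<open>M Q y\<close> or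
      empty.\<close>
    then show ?case using cM[of Q y] by (cases "b = v") simp_all
  next
    case (Query x t)
    let ?A = "\<lambda>r. M Q y \<inter> {f. f x = r} \<inter> {f. accepts f (t r) = v}"
    have split: "measure_pmf.prob F (M Q y \<inter> {f. accepts f (Query x t) = v})
        = measure_pmf.prob F (?A 0) + measure_pmf.prob F (?A 1)" for F
    proof -
      have "M Q y \<inter> {f. accepts f (Query x t) = v} = ?A 0 \<union> ?A 1"
      proof (rule set_eqI)
        fix f show "f \<in> M Q y \<inter> {f. accepts f (Query x t) = v} \<longleftrightarrow> f \<in> ?A 0 \<union> ?A 1"
          by (cases "f x") auto
      qed
      moreover have "?A 0 \<inter> ?A 1 = {}" by auto
      ultimately show ?thesis by (simp only: measure_pmf.finite_measure_Union sets_measure_pmf UNIV_I)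
    qed
    have "c * measure_pmf.prob E (?A r) \<le> measure_pmf.prob D (?A r)" for r
    \<comment> \<open>A repeated query whose recorded reply differs from \<open>r\<close> makes the
      branch impossible. Otherwise adding the reply \<open>r\<close> at \<open>x\<close> to the
      record gives an event of the same form.\<close>
    proof (cases "x \<in> Q \<and> y x \<noteq> r")
      case True
      then have "?A r = {}" by (auto simp: M_def)
      then show ?thesis by (simp only: measure_empty)
    next
      case False
      have eq: "M Q y \<inter> {f. f x = r} = M (insert x Q) (y(x := r))"
      proof (rule set_eqI)
        fix f show "f \<in> M Q y \<inter> {f. f x = r} \<longleftrightarrow> f \<in> M (insert x Q) (y(x := r))"
          using False by (cases "f x = r") (auto simp: M_def)
      qed
      have "card (insert x Q) \<le> Suc (card Q)"
        using Query.prems by (simp add: card_insert_if)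
      moreover have "query_count (t r) \<le> max (query_count (t 0)) (query_count (t 1))"
        by (cases r) simp_all
      ultimately have "card (insert x Q) + query_count (t r) \<le> q"
        using Query.prems(4) by simp
      moreover have "queried (t r) \<subseteq> U" "x \<in> U"
        using Query.prems(3) by auto
      ultimately show ?thesis
        unfolding eq using Query.prems(1,2) by (intro Query.IH) auto
    qed
    from this[of 0] this[of 1] show ?case
      unfolding split by (simp only: distrib_left add_mono)
  qed
  from this[of "{}" undefined] show ?thesis
    using t by (simp add: M_def)
qed

subsection \<open>Random samples and random functions\<close>

text \<open>By \<open>choose_mult\<close>, a uniform \<open>u\<close>-subset contains
  \<open>S\<close> with probability \<open>(u choose s) / (N choose s)\<close>, where
  \<open>s = card S\<close> and \<open>N = card X\<close>; this is at most
  \<open>(u / N) ^ s\<close>.\<close>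

lemma card_supersets_le:
  assumes "finite X" "S \<subseteq> X" "u \<le> card X"
  shows "card X ^ card S * card {U. U \<subseteq> X \<and> card U = u \<and> S \<subseteq> U} \<le> u ^ card S * (card X choose u)"
proof (cases "card S \<le> u")
  case True
  let ?N = "card X" and ?s = "card S"
  have "?N ^ ?s * ((?N - ?s) choose (u - ?s)) * (?N choose ?s) = ?N ^ ?s * (u choose ?s) * (?N choose u)"
    using choose_mult[of ?s u ?N] True assms by (simp add: ac_simps)
  also have "\<dots> \<le> u ^ ?s * (?N choose ?s) * (?N choose u)"
    by (intro mult_le_mono1 binomial_ratio_le_power assms)
  finally have "(?N choose ?s) * (?N ^ ?s * ((?N - ?s) choose (u - ?s)))
      \<le> (?N choose ?s) * (u ^ ?s * (?N choose u))"
    by (simp add: ac_simps)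
  moreover have "?N choose ?s > 0"
    using True assms by simp
  ultimately show ?thesis
    using card_supersets[OF assms(1,2) True] by simp
next
  case False
  have "{U. U \<subseteq> X \<and> card U = u \<and> S \<subseteq> U} = {}"
    using False assms(1) by (auto dest: card_mono[rotated] finite_subset)
  then show ?thesis by (simp only: card.empty)
qed

text \<open>Single out one point \<open>x\<close> of \<open>S\<close> and fix the rest
  \<open>T\<close>: the products over \<open>T\<close> are then constant signs, and Hoeffding's
  inequality applies to the free choice of \<open>x\<close> alone. There are at most
  \<open>(2 ^ n) ^ s\<close> choices of \<open>T\<close>.\<close>

lemma card_unbalanced_sets:
  assumes B: "B \<subseteq> {..<n}" "B \<noteq> {}" and l: "0 \<le> l"
  shows "real (card {S. S \<subseteq> cube n \<and> card S = Suc s \<and> \<bar>\<Sum>i\<in>B. \<Prod>x\<in>S. bit_sign (x i)\<bar> \<ge> l})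
    \<le> 2 * (2 ^ n) ^ Suc s * exp (- l\<^sup>2 / (2 * card B))"
proof -
  let ?N = "2 ^ n :: nat"
  let ?E = "exp (- l\<^sup>2 / (2 * card B))"
  let ?T = "{T. T \<subseteq> cube n \<and> card T = s}"
  let ?X = "\<lambda>T. {x \<in> cube n. \<bar>\<Sum>i\<in>B. (\<Prod>y\<in>T. bit_sign (y i)) * bit_sign (x i)\<bar> \<ge> l}"
  have "{S. S \<subseteq> cube n \<and> card S = Suc s \<and> \<bar>\<Sum>i\<in>B. \<Prod>x\<in>S. bit_sign (x i)\<bar> \<ge> l}
      \<subseteq> (\<Union>T\<in>?T. (\<lambda>x. insert x T) ` ?X T)"
  proof safe
    fix S assume S: "S \<subseteq> cube n" "card S = Suc s" "\<bar>\<Sum>i\<in>B. \<Prod>x\<in>S. bit_sign (x i)\<bar> \<ge> l"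
    obtain x T where T: "S = insert x T" "x \<notin> T" "card T = s" "finite T"
      using S(2) by (metis card_Suc_eq_finite)
    have "x \<in> ?X T" "T \<in> ?T"
      using S T by (auto simp: mult.commute)
    then show "S \<in> (\<Union>T\<in>?T. (\<lambda>x. insert x T) ` ?X T)"
      using T by blast
  qed
  then have "card {S. S \<subseteq> cube n \<and> card S = Suc s \<and> \<bar>\<Sum>i\<in>B. \<Prod>x\<in>S. bit_sign (x i)\<bar> \<ge> l}
      \<le> card (\<Union>T\<in>?T. (\<lambda>x. insert x T) ` ?X T)"
    by (rule card_mono[rotated]) auto
  also have "\<dots> \<le> (\<Sum>T\<in>?T. card ((\<lambda>x. insert x T) ` ?X T))"
    by (rule card_UN_le) simp
  also have "\<dots> \<le> (\<Sum>T\<in>?T. card (?X T))"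
    by (intro sum_mono card_image_le) simp
  finally have "real (card {S. S \<subseteq> cube n \<and> card S = Suc s \<and> \<bar>\<Sum>i\<in>B. \<Prod>x\<in>S. bit_sign (x i)\<bar> \<ge> l})
      \<le> (\<Sum>T\<in>?T. real (card (?X T)))"
    by (simp only: of_nat_sum [symmetric] of_nat_le_iff)
  also have "\<dots> \<le> (\<Sum>T\<in>?T. 2 * 2 ^ n * ?E)"
  proof (rule sum_mono)
    fix T
    show "real (card (?X T)) \<le> 2 * 2 ^ n * ?E"
      using signed_sum_tail_abs[of "{..<n}" B "\<lambda>i. \<Prod>y\<in>T. bit_sign (y i)" l] B l
      by (simp add: abs_prod_bit_sign cube_def)
  qed
  also have "\<dots> = real (?N choose s) * (2 * 2 ^ n * ?E)"
    by (simp add: n_subsets card_cube)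
  also have "\<dots> \<le> real (?N ^ s) * (2 * 2 ^ n * ?E)"
    using binomial_le_pow[of s ?N] 
    by (intro mult_right_mono of_nat_mono) (cases "s \<le> ?N", auto simp: binomial_eq_0)
  also have "\<dots> = 2 * (2 ^ n) ^ Suc s * ?E"
    by simp
  finally show ?thesis .
qed

text \<open>In Fourier terms: for a uniformly chosen coordinate of a block of size \<open>m\<close>,
  every nontrivial character of at most \<open>q\<close> points of \<open>U\<close> has bias at most
  \<open>l / m\<close>.\<close>

definition balanced :: "nat \<Rightarrow> (nat \<Rightarrow> nat set) \<Rightarrow> real \<Rightarrow> nat \<Rightarrow> point set \<Rightarrow> bool" where
  "balanced K B l q U \<longleftrightarrow> (\<forall>S j. S \<subseteq> U \<and> S \<noteq> {} \<and> card S \<le> q \<and> j < K \<longrightarrow>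
     \<bar>\<Sum>i\<in>B j. \<Prod>x\<in>S. bit_sign (x i)\<bar> \<le> l)"

text \<open>Union bound over sizes \<open>s\<close>, blocks \<open>j\<close> and unbalanced sets
  \<open>S\<close>: about \<open>N ^ s\<close> times the Hoeffding factor bounds the number of such
  \<open>S\<close>, and each lies in the sample with probability at most \<open>(u / N) ^ s\<close>.
  The powers of \<open>N = 2 ^ n\<close> cancel, leaving \<open>u ^ s\<close>.\<close>

lemma prob_unbalanced_sample:
  assumes B: "\<And>j. j < K \<Longrightarrow> B j \<subseteq> {..<n} \<and> card (B j) = m" and m: "0 < m" and l: "0 \<le> l"
    and u: "0 < u" "u \<le> 2 ^ n"
  shows "measure_pmf.prob (pmf_of_set (samples n u)) {U. \<not> balanced K B l q U}
    \<le> 2 * real q * real K * real u ^ q * exp (- l\<^sup>2 / (2 * m))"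
proof -
  let ?N = "2 ^ n :: nat"
  let ?E = "exp (- l\<^sup>2 / (2 * m))"
  define F where "F s j = {S. S \<subseteq> cube n \<and> card S = s \<and> \<bar>\<Sum>i\<in>B j. \<Prod>x\<in>S. bit_sign (x i)\<bar> \<ge> l}" for s j
  define G where "G S = {U. U \<subseteq> cube n \<and> card U = u \<and> S \<subseteq> U}" for S
  have finF: "finite (F s j)" for s j
    unfolding F_def by (rule finite_subset[of _ "Pow (cube n)"]) auto
  have finG: "finite (G S)" for S
    unfolding G_def by (rule finite_subset[of _ "Pow (cube n)"]) auto
  have cardF: "real (card (F s j)) \<le> 2 * (2 ^ n) ^ s * ?E" if "1 \<le> s" "j < K" for s j
  proof -
    have "B j \<subseteq> {..<n}" "card (B j) = m" using B that by auto
    moreover from this m have "B j \<noteq> {}" by auto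
    ultimately show ?thesis
      using card_unbalanced_sets[of "B j" n l "s - 1"] that l by (simp add: F_def)
  qed
  have cardG: "real (card (G S)) \<le> (real u / 2 ^ n) ^ s * real (?N choose u)" if "S \<in> F s j" for S s j
  proof -
    have "?N ^ s * card (G S) \<le> u ^ s * (?N choose u)"
      using card_supersets_le[of "cube n" S u] that u unfolding F_def G_def by (simp add: card_cube)
    then have "real (?N ^ s * card (G S)) \<le> real (u ^ s * (?N choose u))"
      by (simp only: of_nat_le_iff)
    then show ?thesis by (simp add: power_divide field_simps)
  qed
  have "samples n u \<inter> {U. \<not> balanced K B l q U} \<subseteq> (\<Union>s\<in>{1..q}. \<Union>j\<in>{..<K}. \<Union>S\<in>F s j. G S)"
  proof
    fix U assume U: "U \<in> samples n u \<inter> {U. \<not> balanced K B l q U}"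
    then obtain S j where S: "S \<subseteq> U" "S \<noteq> {}" "card S \<le> q" "j < K"
        "\<bar>\<Sum>i\<in>B j. \<Prod>x\<in>S. bit_sign (x i)\<bar> > l"
      unfolding balanced_def by (auto simp: not_le)
    have U': "U \<subseteq> cube n" "card U = u" using U by (auto simp: samples_def)
    have "finite S" using S U' finite_cube by (meson finite_subset)
    with S have "card S \<in> {1..q}" by (simp add: Suc_le_eq card_gt_0_iff)
    moreover have "S \<in> F (card S) j" "U \<in> G S"
      using S U' by (auto simp: F_def G_def)
    ultimately show "U \<in> (\<Union>s\<in>{1..q}. \<Union>j\<in>{..<K}. \<Union>S\<in>F s j. G S)"
      using S(4) by blast
  qed
  then have "card (samples n u \<inter> {U. \<not> balanced K B l q U}) \<le> card (\<Union>s\<in>{1..q}. \<Union>j\<in>{..<K}. \<Union>S\<in>F s j. G S)"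
    using finF finG by (intro card_mono) auto
  also have "\<dots> \<le> (\<Sum>s\<in>{1..q}. \<Sum>j\<in>{..<K}. \<Sum>S\<in>F s j. card (G S))"
    using finF by (intro order.trans[OF card_UN_le] sum_mono) auto
  finally have "real (card (samples n u \<inter> {U. \<not> balanced K B l q U}))
      \<le> (\<Sum>s\<in>{1..q}. \<Sum>j\<in>{..<K}. \<Sum>S\<in>F s j. real (card (G S)))"
    by (simp only: of_nat_sum [symmetric] of_nat_le_iff)
  also have "\<dots> \<le> (\<Sum>s\<in>{1..q}. \<Sum>j\<in>{..<K}. 2 * real u ^ q * ?E * real (?N choose u))"
  proof (intro sum_mono)
    fix s j assume s: "s \<in> {1..q}" and j: "j \<in> {..<K}"
    have "(\<Sum>S\<in>F s j. real (card (G S))) \<le> real (card (F s j)) * ((real u / 2 ^ n) ^ s * real (?N choose u))"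
      using cardG by (rule sum_bounded_above)
    also have "\<dots> \<le> 2 * (2 ^ n) ^ s * ?E * ((real u / 2 ^ n) ^ s * real (?N choose u))"
      using cardF[of s j] s j by (intro mult_right_mono) auto
    also have "\<dots> = 2 * real u ^ s * ?E * real (?N choose u)"
      by (simp add: power_divide)
    also have "\<dots> \<le> 2 * real u ^ q * ?E * real (?N choose u)"
      using s u by (intro mult_right_mono mult_left_mono power_increasing) auto
    finally show "(\<Sum>S\<in>F s j. real (card (G S))) \<le> 2 * real u ^ q * ?E * real (?N choose u)" .
  qed
  also have "\<dots> = 2 * real q * real K * real u ^ q * ?E * real (?N choose u)"
    by simp
  finally have "real (card (samples n u \<inter> {U. \<not> balanced K B l q U}))
      \<le> 2 * real q * real K * real u ^ q * ?E * real (?N choose u)" .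
  moreover have "?N choose u > 0" using u by simp
  ultimately show ?thesis
    using u by (simp add: measure_pmf_of_set samples_nonempty card_samples divide_le_eq)
qed

section \<open>The size of \<open>Lin\<close>, and the distance of random functions from a finite
  family\<close>

lemma Lin_conv_image: "Lin n k = (\<lambda>I. restrict (\<lambda>x. \<Sum>i\<in>I. x i) (cube n)) ` {I. I \<subseteq> {..<n} \<and> card I = k}"
  unfolding Lin_def by auto

lemma finite_Lin [simp]: "finite (Lin n k)"
  unfolding Lin_conv_image by (rule finite_imageI, rule finite_subset[of _ "Pow {..<n}"]) auto

lemma card_Lin_le: "card (Lin n k) \<le> n choose k"
  unfolding Lin_conv_image
  by (rule order.trans[OF card_image_le]) (auto simp: n_subsets intro: finite_subset[of _ "Pow {..<n}"])

text \<open>Being within distance \<open>\<epsilon> * 2 ^ n\<close> of \<open>g\<close> means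
  correlation at least \<open>(1 - 2 * \<epsilon>) * 2 ^ n\<close> with \<open>g\<close>.
  Hoeffding's inequality is applied to the truth table of \<open>f\<close>, with the points of the
  cube as index set, followed by a union bound over \<open>P\<close>.\<close>

lemma prob_not_far:
  assumes \<epsilon>: "\<epsilon> < 1 / 2" and P: "finite P"
  shows "measure_pmf.prob (pmf_of_set (boolean_functions n)) {f. \<not> far n \<epsilon> P f}
    \<le> real (card P) * exp (- (1 - 2 * \<epsilon>)\<^sup>2 * 2 ^ n / 2)"
proof -
  let ?F = "boolean_functions n"
  let ?t = "(1 - 2 * \<epsilon>) * 2 ^ n"
  define H where "H g = {f \<in> ?F. (\<Sum>x\<in>cube n. bit_sign (g x) * bit_sign (f x)) \<ge> ?t}" for g
  have "?F \<inter> {f. \<not> far n \<epsilon> P f} \<subseteq> (\<Union>g\<in>P. H g)"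
  proof
    fix f assume f: "f \<in> ?F \<inter> {f. \<not> far n \<epsilon> P f}"
    then obtain g where g: "g \<in> P" "real (card {x \<in> cube n. f x \<noteq> g x}) < \<epsilon> * 2 ^ n"
      by (auto simp: far_def not_le)
    have "bit_sign (g x) * bit_sign (f x) = 1 - 2 * (if f x \<noteq> g x then 1 else 0)" for x
      by (cases "f x"; cases "g x") (auto simp: bit_sign_def)
    then have "(\<Sum>x\<in>cube n. bit_sign (g x) * bit_sign (f x))
        = real (card (cube n)) - 2 * (\<Sum>x\<in>cube n. if f x \<noteq> g x then 1 else 0)"
      by (simp add: sum_subtractf flip: sum_distrib_left)
    also have "(\<Sum>x\<in>cube n. if f x \<noteq> g x then 1 else 0) = real (card {x \<in> cube n. f x \<noteq> g x})"
      by (simp add: sum.If_cases Int_def)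
    finally have "(\<Sum>x\<in>cube n. bit_sign (g x) * bit_sign (f x)) \<ge> ?t"
      using g(2) by (simp add: card_cube algebra_simps)
    then show "f \<in> (\<Union>g\<in>P. H g)" using f g(1) by (auto simp: H_def)
  qed
  then have "card (?F \<inter> {f. \<not> far n \<epsilon> P f}) \<le> card (\<Union>g\<in>P. H g)"
    using P by (intro card_mono) (auto simp: H_def)
  also have "\<dots> \<le> (\<Sum>g\<in>P. card (H g))"
    by (rule card_UN_le[OF P])
  finally have "real (card (?F \<inter> {f. \<not> far n \<epsilon> P f})) \<le> (\<Sum>g\<in>P. real (card (H g)))"
    by (simp only: of_nat_sum [symmetric] of_nat_le_iff)
  also have "\<dots> \<le> (\<Sum>g\<in>P. real (card ?F) * exp (- (1 - 2 * \<epsilon>)\<^sup>2 * 2 ^ n / 2))"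
  proof (rule sum_mono)
    fix g
    have "cube n \<noteq> {}" by (simp add: cube_def PiE_eq_empty_iff)
    then have "real (card (H g)) \<le> 2 ^ card (cube n) * exp (- ?t\<^sup>2 / (2 * card (cube n)))"
      unfolding H_def boolean_functions_def using \<epsilon> by (intro signed_sum_tail) auto
    also have "- ?t\<^sup>2 / (2 * card (cube n)) = - (1 - 2 * \<epsilon>)\<^sup>2 * 2 ^ n / 2"
      by (simp add: card_cube power_mult_distrib) (simp add: power2_eq_square)
    also have "2 ^ card (cube n) = real (card ?F)"
      by (simp add: boolean_functions_def card_funcsetE UNIV_bit numeral_2_eq_2)
    finally show "real (card (H g)) \<le> real (card ?F) * exp (- (1 - 2 * \<epsilon>)\<^sup>2 * 2 ^ n / 2)" .
  qed
  finally have "real (card (?F \<inter> {f. \<not> far n \<epsilon> P f}))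
      \<le> real (card P) * exp (- (1 - 2 * \<epsilon>)\<^sup>2 * 2 ^ n / 2) * real (card ?F)"
    by (simp add: ac_simps)
  moreover have "card ?F > 0" by (simp add: card_gt_0_iff)
  ultimately show ?thesis by (simp add: measure_pmf_of_set divide_le_eq)
qed

subsection \<open>Testing by consistency\<close>

text \<open>The second argument carries the candidates that agree with all replies so far; the run
  accepts if one survives.\<close>

primrec consistency_strategy :: "point list \<Rightarrow> boolean_function set \<Rightarrow> strategy" where
  "consistency_strategy [] P = Verdict (P \<noteq> {})"
| "consistency_strategy (x # xs) P = Query x (\<lambda>r. consistency_strategy xs {g \<in> P. g x = r})"

lemma accepts_consistency_strategy:
  "accepts f (consistency_strategy xs P) \<longleftrightarrow> (\<exists>g\<in>P. \<forall>x\<in>set xs. g x = f x)"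
  by (induction xs arbitrary: P) auto

lemma queried_consistency_strategy: "queried (consistency_strategy xs P) \<subseteq> set xs"
  by (induction xs arbitrary: P) auto

lemma query_count_consistency_strategy: "query_count (consistency_strategy xs P) = length xs"
  by (induction xs arbitrary: P) auto

text \<open>The sample must fall inside the agreement set, which has density at most
  \<open>1 - \<epsilon>\<close>.\<close>

lemma prob_agree_on_sample:
  assumes q: "q \<le> 2 ^ n" and d: "real (card {x \<in> cube n. f x \<noteq> g x}) \<ge> \<epsilon> * 2 ^ n"
  shows "measure_pmf.prob (pmf_of_set (samples n q)) {U. \<forall>x\<in>U. g x = f x} \<le> (1 - \<epsilon>) ^ q"
proof -
  let ?N = "2 ^ n :: nat"
  let ?A = "{x \<in> cube n. g x = f x}"
  have "card ?A + card {x \<in> cube n. f x \<noteq> g x} = card (?A \<union> {x \<in> cube n. f x \<noteq> g x})"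
    by (rule card_Un_disjoint [symmetric]) auto
  also have "?A \<union> {x \<in> cube n. f x \<noteq> g x} = cube n" by auto
  finally have "card ?A + card {x \<in> cube n. f x \<noteq> g x} = ?N" by (simp add: card_cube)
  then have sum: "real (card ?A + card {x \<in> cube n. f x \<noteq> g x}) = real ?N"
    by (simp only:)
  then have "real (card ?A) \<le> (1 - \<epsilon>) * 2 ^ n"
    using d by (simp add: algebra_simps)
  then have cA: "real (card ?A) / 2 ^ n \<le> 1 - \<epsilon>"
    by (simp only: pos_divide_le_eq zero_less_power zero_less_numeral)
  have "card ?A \<le> ?N" using card_mono[of "cube n" ?A] by (simp add: card_cube)
  then have "?N ^ q * (card ?A choose q) \<le> card ?A ^ q * (?N choose q)"
    by (rule binomial_ratio_le_power)
  then have "real (?N ^ q * (card ?A choose q)) \<le> real (card ?A ^ q * (?N choose q))"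
    by (simp only: of_nat_le_iff)
  then have "real (card ?A choose q) \<le> (real (card ?A) / 2 ^ n) ^ q * real (?N choose q)"
    by (simp add: power_divide pos_le_divide_eq mult.commute)
  also have "\<dots> \<le> (1 - \<epsilon>) ^ q * real (?N choose q)"
    using cA by (intro mult_right_mono power_mono) auto
  finally have *: "real (card ?A choose q) \<le> (1 - \<epsilon>) ^ q * real (?N choose q)" .
  have "samples n q \<inter> {U. \<forall>x\<in>U. g x = f x} = {U. U \<subseteq> ?A \<and> card U = q}"
    by (auto simp: samples_def)
  then have "card (samples n q \<inter> {U. \<forall>x\<in>U. g x = f x}) = card ?A choose q"
    by (simp add: n_subsets)
  moreover have "?N choose q > 0" using q by simp
  ultimately show ?thesis
    using q * by (simp add: measure_pmf_of_set samples_nonempty card_samples divide_le_eq)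
qed

text \<open>Members of \<open>P\<close> are always accepted. A far function is accepted only if some
  \<open>g\<close> in \<open>P\<close> agrees with it on the whole sample, which a union bound over
  \<open>P\<close> controls.\<close>

lemma consistency_tester:
  assumes q: "q \<le> 2 ^ n" and P: "finite P" and small: "real (card P) * (1 - \<epsilon>) ^ q \<le> 1 / 3"
  shows "\<exists>A. is_tester n P \<epsilon> q q A"
proof -
  \<comment> \<open>The sample is a set; an arbitrary enumeration without repetition fixes the query
    order and gives exactly \<open>q\<close> queries.\<close>
  define L where "L U = (SOME xs :: point list. set xs = U \<and> distinct xs)" for U
  define T where "T U = consistency_strategy (L U) P" for U
  have L: "set (L U) = U" "distinct (L U)" if "U \<in> samples n q" for U
  proof -
    have "finite U" using that finite_cube[of n] unfolding samples_def by (blast intro: finite_subset)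
    then have "\<exists>xs. set xs = U \<and> distinct xs" by (rule finite_distinct_list)
    then have "set (L U) = U \<and> distinct (L U)" unfolding L_def by (rule someI_ex)
    then show "set (L U) = U" "distinct (L U)" by auto
  qed
  have set: "set_pmf (pmf_of_set (samples n q)) = samples n q"
    using q by (simp add: samples_nonempty)
  have run: "run n q (\<lambda>U. return_pmf (T U)) = map_pmf T (pmf_of_set (samples n q))"
    by (simp add: run_def map_pmf_def)
  have acc: "accepts f (T U) \<longleftrightarrow> (\<exists>g\<in>P. \<forall>x\<in>U. g x = f x)" if "U \<in> samples n q" for U f
    using L(1)[OF that] by (simp add: T_def accepts_consistency_strategy)
  have "is_tester n P \<epsilon> q q (\<lambda>U. return_pmf (T U))"
    unfolding is_tester_def
  proof (intro conjI ballI impI)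
    fix U t assume U: "U \<in> samples n q" and t: "t \<in> set_pmf (return_pmf (T U))"
    show "queried t \<subseteq> U"
      using t queried_consistency_strategy[of "L U" P] L(1)[OF U] by (simp add: T_def)
    show "query_count t \<le> q"
      using t L[OF U] U distinct_card[of "L U"]
      by (simp add: T_def query_count_consistency_strategy samples_def)
  next
    fix f assume "f \<in> P"
    then have "measure_pmf.prob (run n q (\<lambda>U. return_pmf (T U))) {t. accepts f t} = 1"
      unfolding run by (intro measure_pmf.prob_eq_1[THEN iffD2]) (auto simp: AE_measure_pmf_iff set acc)
    then show "measure_pmf.prob (run n q (\<lambda>U. return_pmf (T U))) {t. accepts f t} \<ge> 2 / 3" by simp
  next
    fix f assume far: "far n \<epsilon> P f"
    let ?S = "measure_pmf.prob (pmf_of_set (samples n q))"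
    have "?S {U. accepts f (T U)} = ?S {U. \<exists>g\<in>P. \<forall>x\<in>U. g x = f x}"
      by (intro measure_pmf.finite_measure_eq_AE) (auto simp: AE_measure_pmf_iff set acc)
    also have "{U. \<exists>g\<in>P. \<forall>x\<in>U. g x = f x} = (\<Union>g\<in>P. {U. \<forall>x\<in>U. g x = f x})" by auto
    also have "?S \<dots> \<le> (\<Sum>g\<in>P. ?S {U. \<forall>x\<in>U. g x = f x})"
      using P by (intro measure_pmf.finite_measure_subadditive_finite) auto
    also have "\<dots> \<le> (\<Sum>g\<in>P. (1 - \<epsilon>) ^ q)"
      using far q by (intro sum_mono prob_agree_on_sample) (auto simp: far_def)
    also have "\<dots> \<le> 1 / 3" using small by simp
    finally have "?S {U. accepts f (T U)} \<le> 1 / 3" .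
    moreover have "?S {U. \<not> accepts f (T U)} = 1 - ?S {U. accepts f (T U)}"
    proof -
      have "{U. \<not> accepts f (T U)} = space (pmf_of_set (samples n q)) - {U. accepts f (T U)}" by auto
      then show ?thesis by (simp only: measure_pmf.prob_compl sets_measure_pmf UNIV_I)
    qed
    moreover have "measure_pmf.prob (run n q (\<lambda>U. return_pmf (T U))) {t. \<not> accepts f t}
        = ?S {U. \<not> accepts f (T U)}"
      unfolding run by (simp add: vimage_def)
    ultimately show "measure_pmf.prob (run n q (\<lambda>U. return_pmf (T U))) {t. \<not> accepts f t} \<ge> 2 / 3"
      by simp
  qed (use q in auto)
  then show ?thesis by blast
qed

section \<open>Passing to larger samples\<close>

text \<open>Double counting of pairs of a \<open>q\<close>-set inside a \<open>u\<close>-set: every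
  \<open>q\<close>-set lies in equally many \<open>u\<close>-sets, and \<open>choose_mult\<close>
  identifies the resulting constant as \<open>1 / (2 ^ n choose q)\<close>.\<close>

lemma random_subsample:
  assumes "q \<le> u" "u \<le> 2 ^ n"
  shows "bind_pmf (pmf_of_set (samples n u)) (\<lambda>U. pmf_of_set {S. S \<subseteq> U \<and> card S = q})
    = pmf_of_set (samples n q)"
proof (rule pmf_eqI)
  fix S
  let ?N = "2 ^ n :: nat"
  have qn: "q \<le> ?N" using assms by simp
  have sub: "{V. V \<subseteq> U \<and> card V = q} \<noteq> {}" "finite {V. V \<subseteq> U \<and> card V = q}"
    "card {V. V \<subseteq> U \<and> card V = q} = u choose q" if "U \<in> samples n u" for U
  proof -
    have U: "finite U" "card U = u"
      using that finite_cube[of n] unfolding samples_def by (auto intro: finite_subset)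
    then show c: "card {V. V \<subseteq> U \<and> card V = q} = u choose q" by (simp add: n_subsets)
    show "finite {V. V \<subseteq> U \<and> card V = q}" using U by simp
    show "{V. V \<subseteq> U \<and> card V = q} \<noteq> {}"
      using c assms(1) by (metis card.empty zero_less_binomial less_irrefl)
  qed
  have "pmf (bind_pmf (pmf_of_set (samples n u)) (\<lambda>U. pmf_of_set {S. S \<subseteq> U \<and> card S = q})) S
      = (\<Sum>U\<in>samples n u. pmf (pmf_of_set {S. S \<subseteq> U \<and> card S = q}) S) / real (?N choose u)"
    using assms by (simp add: pmf_bind_pmf_of_set samples_nonempty card_samples)
  also have "(\<Sum>U\<in>samples n u. pmf (pmf_of_set {S. S \<subseteq> U \<and> card S = q}) S)
      = (\<Sum>U\<in>samples n u. if S \<subseteq> U \<and> card S = q then 1 / real (u choose q) else 0)"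
  proof (rule sum.cong[OF refl])
    fix U assume U: "U \<in> samples n u"
    show "pmf (pmf_of_set {S. S \<subseteq> U \<and> card S = q}) S
        = (if S \<subseteq> U \<and> card S = q then 1 / real (u choose q) else 0)"
      using pmf_of_set[OF sub(1,2)[OF U]] sub(3)[OF U] by (simp add: indicator_def)
  qed
  also have "\<dots> = real (card {U \<in> samples n u. S \<subseteq> U \<and> card S = q}) / real (u choose q)"
    by (simp add: sum.If_cases Int_def)
  also have "{U \<in> samples n u. S \<subseteq> U \<and> card S = q} =
      (if S \<in> samples n q then {U. U \<subseteq> cube n \<and> card U = u \<and> S \<subseteq> U} else {})"
    by (auto simp: samples_def)
  also have "real (card \<dots>) = indicator (samples n q) S * real ((?N - q) choose (u - q))"
    using assms card_supersets[of "cube n" S u] by (auto simp: samples_def card_cube indicator_def)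
  also have "indicator (samples n q) S * real ((?N - q) choose (u - q)) / real (u choose q) / real (?N choose u)
      = indicator (samples n q) S / real (?N choose q)"
  proof -
    have "real (?N choose u) * real (u choose q) = real (?N choose q) * real ((?N - q) choose (u - q))"
      using choose_mult[OF assms] by (metis of_nat_mult)
    moreover have "(?N choose u) > 0" "(u choose q) > 0" "(?N choose q) > 0"
      using assms qn by auto
    ultimately show ?thesis by (simp add: field_simps)
  qed
  also have "\<dots> = pmf (pmf_of_set (samples n q)) S"
    using qn by (simp add: samples_nonempty card_samples)
  finally show "pmf (bind_pmf (pmf_of_set (samples n u)) (\<lambda>U. pmf_of_set {S. S \<subseteq> U \<and> card S = q})) S
      = pmf (pmf_of_set (samples n q)) S" .
qed

text \<open>Running \<open>A\<close> on a uniform \<open>q\<close>-subset of the sample leaves the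
  law of the executed strategy unchanged. This turns passive testers into active ones, and also
  transfers lower bounds from active to passive testing.\<close>

lemma is_tester_larger_sample:
  assumes A: "is_tester n P \<epsilon> q r A" and u: "q \<le> u" "u \<le> 2 ^ n"
  shows "\<exists>A'. is_tester n P \<epsilon> u r A'"
proof
  let ?A' = "\<lambda>U. bind_pmf (pmf_of_set {S. S \<subseteq> U \<and> card S = q}) A"
  have run: "run n u ?A' = run n q A"
    unfolding run_def by (simp add: random_subsample[OF u] flip: bind_assoc_pmf)
  show "is_tester n P \<epsilon> u r ?A'"
    unfolding is_tester_def run
  proof (intro conjI ballI impI)
    fix U t assume U: "U \<in> samples n u" and t: "t \<in> set_pmf (?A' U)"
    have fU: "finite U" "card U = u" "U \<subseteq> cube n"
      using U finite_cube[of n] unfolding samples_def by (auto intro: finite_subset)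
    have "card {S. S \<subseteq> U \<and> card S = q} > 0" using fU u by (simp add: n_subsets)
    then have "set_pmf (pmf_of_set {S. S \<subseteq> U \<and> card S = q}) = {S. S \<subseteq> U \<and> card S = q}"
      by (intro set_pmf_of_set) (auto simp: card_gt_0_iff)
    with t obtain S where "S \<subseteq> U" "card S = q" "t \<in> set_pmf (A S)"
      by (auto simp: set_bind_pmf)
    moreover from this fU have "S \<in> samples n q" by (auto simp: samples_def)
    ultimately have "queried t \<subseteq> S \<and> query_count t \<le> r"
      using A unfolding is_tester_def by blast
    then show "queried t \<subseteq> U" "query_count t \<le> r" using \<open>S \<subseteq> U\<close> by auto
  qed (use A u in \<open>auto simp: is_tester_def\<close>)
qed

subsection \<open>The query lower bound\<close>

lemma prob_uniform_function_match:
  assumes Q: "Q \<subseteq> cube n"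
  shows "measure_pmf.prob (pmf_of_set (boolean_functions n)) {f. \<forall>x\<in>Q. f x = y x} = 1 / 2 ^ card Q"
proof -
  let ?F = "boolean_functions n"
  have fQ: "finite Q" using Q finite_cube by (rule finite_subset)
  have "?F \<inter> {f. \<forall>x\<in>Q. f x = y x} = PiE (cube n) (\<lambda>x. if x \<in> Q then {y x} else UNIV)"
    using Q unfolding boolean_functions_def
    by (auto simp: PiE_iff split: if_splits)
  then have "card (?F \<inter> {f. \<forall>x\<in>Q. f x = y x}) = (\<Prod>x\<in>cube n. if x \<in> Q then 1 else 2)"
    by (simp add: card_PiE if_distrib[of card] UNIV_bit numeral_2_eq_2 cong: if_cong)
  also have "\<dots> = 2 ^ card (cube n - Q)"
    using Q by (simp add: prod.If_cases Diff_eq)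
  finally have 1: "card (?F \<inter> {f. \<forall>x\<in>Q. f x = y x}) = 2 ^ card (cube n - Q)" .
  have 2: "card ?F = 2 ^ card (cube n)"
    by (simp add: boolean_functions_def card_funcsetE UNIV_bit numeral_2_eq_2)
  have "card (cube n) = card (cube n - Q) + card Q"
    using Q fQ card_mono[OF finite_cube Q] by (simp add: card_Diff_subset)
  then show ?thesis
    by (simp add: measure_pmf_of_set 1 2 power_add)
qed

section \<open>Random parities with one coordinate per block\<close>

definition block :: "nat \<Rightarrow> nat \<Rightarrow> nat set" where
  "block m j = {j * m..<j * m + m}"

definition block_parity :: "nat \<Rightarrow> nat \<Rightarrow> (nat \<Rightarrow> nat) \<Rightarrow> boolean_function" where
  "block_parity n K i = restrict (\<lambda>x. \<Sum>j<K. x (i j)) (cube n)"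

lemma block_subset:
  assumes "j < K" "K * m \<le> n"
  shows "block m j \<subseteq> {..<n}"
proof -
  have "Suc j * m \<le> K * m" using assms(1) by (intro mult_le_mono1) simp
  then show ?thesis using assms(2) by (auto simp: block_def)
qed

text \<open>Division by \<open>m\<close> recovers the block index from a coordinate, so the
  \<open>K\<close> chosen coordinates are distinct.\<close>

lemma block_parity_in_Lin:
  assumes i: "i \<in> PiE {..<K} (block m)" and n: "K * m \<le> n"
  shows "block_parity n K i \<in> Lin n K"
proof -
  have ij: "i j \<in> block m j" if "j < K" for j
    using i that by (auto simp: PiE_iff)
  have "i j div m = j" if "j < K" for j
    using ij[OF that] unfolding block_def
    by (intro div_nat_eqI) (auto simp: algebra_simps)
  then have inj: "inj_on i {..<K}"
    by (metis inj_onI lessThan_iff)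
  have "i ` {..<K} \<subseteq> {..<n}"
    using ij block_subset[OF _ n] by blast
  moreover have "card (i ` {..<K}) = K"
    using inj by (simp add: card_image)
  moreover have "block_parity n K i = restrict (\<lambda>x. \<Sum>l\<in>i ` {..<K}. x l) (cube n)"
    unfolding block_parity_def by (rule restrict_ext) (simp add: sum.reindex[OF inj])
  ultimately show ?thesis unfolding Lin_def by blast
qed

text \<open>\<open>block_parity_count\<close> divided by the number \<open>m ^ K\<close> of choices.
  The factor 10 in the last hypothesis makes the nontrivial Fourier terms cost at most a tenth of
  the uniform probability.\<close>

lemma block_parity_match:
  assumes Q: "Q \<subseteq> cube n" "card Q \<le> q" and bal: "balanced K (block m) l q Q"
    and m: "0 < m" and l: "0 \<le> l" and small: "10 * 2 ^ q * l ^ K \<le> real m ^ K"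
  shows "measure_pmf.prob (map_pmf (block_parity n K) (pmf_of_set (PiE {..<K} (block m))))
      {f. \<forall>x\<in>Q. f x = y x} \<ge> 9 / 10 / 2 ^ card Q"
proof -
  let ?I = "PiE {..<K} (block m)"
  let ?M = "{i \<in> ?I. \<forall>x\<in>Q. (\<Sum>j<K. x (i j)) = y x}"
  have fQ: "finite Q" using Q(1) finite_cube by (rule finite_subset)
  have finI: "finite ?I" by (intro finite_PiE) (auto simp: block_def)
  have cI: "card ?I = m ^ K" by (simp add: card_PiE block_def)
  have neI: "?I \<noteq> {}" using cI m by (metis card.empty less_irrefl zero_less_power)
  have "2 ^ card Q * l ^ K \<le> 2 ^ q * l ^ K"
    using Q(2) l by (intro mult_right_mono power_increasing) auto
  with small have "2 ^ card Q * l ^ K \<le> real m ^ K / 10" by simp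
  moreover have "real m ^ K - 2 ^ card Q * l ^ K \<le> 2 ^ card Q * real (card ?M)"
  proof (rule block_parity_count)
    fix S j assume S: "S \<subseteq> Q" "S \<noteq> {}" "j < K"
    moreover have "card S \<le> q" using card_mono[OF fQ S(1)] Q(2) by simp
    ultimately show "\<bar>\<Sum>i\<in>block m j. \<Prod>x\<in>S. bit_sign (x i)\<bar> \<le> l"
      using bal unfolding balanced_def by blast
  qed (use fQ l in \<open>auto simp: block_def\<close>)
  ultimately have M: "2 ^ card Q * real (card ?M) \<ge> 9 / 10 * real m ^ K" by linarith
  have "block_parity n K -` {f. \<forall>x\<in>Q. f x = y x} = {i. \<forall>x\<in>Q. (\<Sum>j<K. x (i j)) = y x}"
    using Q(1) by (auto simp: block_parity_def subset_iff)
  then have "measure_pmf.prob (map_pmf (block_parity n K) (pmf_of_set ?I)) {f. \<forall>x\<in>Q. f x = y x}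
      = real (card ?M) / real m ^ K"
    using finI neI cI by (simp add: measure_pmf_of_set Int_def)
  moreover have "9 / 10 / 2 ^ card Q \<le> real (card ?M) / real m ^ K"
    using M m by (simp add: field_simps)
  ultimately show ?thesis by simp
qed

text \<open>Fubini, as commutation of independent draws. It reduces a comparison of two random
  functions to one for each fixed strategy, where \<open>dominated_strategy\<close> applies.\<close>

lemma prob_rejects_swap:
  fixes F :: "boolean_function pmf"
  shows "(\<integral>f. measure_pmf.prob (run n u A) {t. \<not> accepts f t} \<partial>F)
    = (\<integral>U. (\<integral>t. measure_pmf.prob F {f. \<not> accepts f t} \<partial>A U) \<partial>pmf_of_set (samples n u))"
proof -
  have v1: "accepts f -` {False} = {t. \<not> accepts f t}" for f by auto
  have v2: "(\<lambda>f. accepts f t) -` {False} = {f. \<not> accepts f t}" for t by auto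
  have "(\<integral>f. measure_pmf.prob (run n u A) {t. \<not> accepts f t} \<partial>F)
      = pmf (bind_pmf F (\<lambda>f. map_pmf (accepts f) (run n u A))) False"
    by (simp add: pmf_bind pmf_map v1)
  also have "bind_pmf F (\<lambda>f. map_pmf (accepts f) (run n u A))
      = bind_pmf (run n u A) (\<lambda>t. map_pmf (\<lambda>f. accepts f t) F)"
    unfolding map_pmf_def by (rule bind_commute_pmf)
  also have "\<dots> = bind_pmf (pmf_of_set (samples n u)) (\<lambda>U. bind_pmf (A U) (\<lambda>t. map_pmf (\<lambda>f. accepts f t) F))"
    unfolding run_def by (rule bind_assoc_pmf)
  also have "pmf \<dots> False
      = (\<integral>U. (\<integral>t. measure_pmf.prob F {f. \<not> accepts f t} \<partial>A U) \<partial>pmf_of_set (samples n u))"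
    by (simp add: pmf_bind pmf_map v2)
  finally show ?thesis .
qed

lemma integrable_bounded_pmf:
  fixes h :: "'a \<Rightarrow> real"
  assumes "\<And>x. \<bar>h x\<bar> \<le> b"
  shows "integrable (measure_pmf M) h"
  using assms by (intro measure_pmf.integrable_const_bound[where B = b]) auto

text \<open>A block parity is rejected with probability at most 1/3, a uniform function with
  probability at least 2/3 * 9/10 = 3/5. Domination with factor 9/10 outside a bad event of
  probability 1/10 forces the former to be at least 9/10 * (3/5 - 1/10) = 9/20, a
  contradiction.\<close>

lemma tester_query_lower_bound:
  fixes m :: nat and l :: real
  assumes T: "is_tester n (Lin n K) \<epsilon> u q A"
    and \<epsilon>: "\<epsilon> < 1 / 2" and u: "0 < u" and m: "0 < m" "K * m \<le> n" and l: "0 \<le> l"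
    and balanced_whp: "2 * real q * real K * real u ^ q * exp (- l\<^sup>2 / (2 * m)) \<le> 1 / 10"
    and near_uniform: "10 * 2 ^ q * l ^ K \<le> real m ^ K"
    and far_whp: "2 ^ n * exp (- (1 - 2 * \<epsilon>)\<^sup>2 * 2 ^ n / 2) \<le> 1 / 10"
  shows False
proof -
  define D where "D = map_pmf (block_parity n K) (pmf_of_set (PiE {..<K} (block m)))"
  define E where "E = pmf_of_set (boolean_functions n)"
  let ?S = "pmf_of_set (samples n u)"
  let ?rej = "\<lambda>f. measure_pmf.prob (run n u A) {t. \<not> accepts f t}"
  let ?G = "\<lambda>F U. \<integral>t. measure_pmf.prob F {f. \<not> accepts f t} \<partial>A U"
  let ?bad = "{U. \<not> balanced K (block m) l q U}"
  have u2: "u \<le> 2 ^ n" using T by (simp add: is_tester_def)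
  have setS: "set_pmf ?S = samples n u" using u2 by (simp add: samples_nonempty)
  have card_block: "card (block m j) = m" for j by (simp add: block_def)
  have neI: "PiE {..<K} (block m) \<noteq> {}" using m by (auto simp: PiE_eq_empty_iff block_def)
  have finI: "finite (PiE {..<K} (block m))" by (intro finite_PiE) (auto simp: block_def)

  have bad: "measure_pmf.prob ?S ?bad \<le> 1 / 10"
    using prob_unbalanced_sample[of K "block m" n m l u q] block_subset[OF _ m(2)] card_block m l u u2
      balanced_whp by force

  have D: "measure_pmf.expectation D ?rej \<le> 1 / 3"
  proof (rule measure_pmf.integral_le_const)
    show "integrable D ?rej" by (rule integrable_bounded_pmf[where b = 1]) simp
    have "?rej f \<le> 1 / 3" if "f \<in> set_pmf D" for f
    proof -
      have "f \<in> Lin n K" using that block_parity_in_Lin[OF _ m(2)] finI neI by (auto simp: D_def)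
      then have "measure_pmf.prob (run n u A) {t. accepts f t} \<ge> 2 / 3"
        using T by (simp add: is_tester_def)
      moreover have "{t. \<not> accepts f t} = space (run n u A) - {t. accepts f t}" by auto
      then have "?rej f = 1 - measure_pmf.prob (run n u A) {t. accepts f t}"
        by (simp only: measure_pmf.prob_compl sets_measure_pmf UNIV_I)
      ultimately show ?thesis by simp
    qed
    then show "AE f in D. ?rej f \<le> 1 / 3" by (simp add: AE_measure_pmf_iff)
  qed

  have E: "measure_pmf.expectation E ?rej \<ge> 3 / 5"
  proof -
    let ?far = "{f. far n \<epsilon> (Lin n K) f}"
    have "measure_pmf.prob E {f. \<not> far n \<epsilon> (Lin n K) f} \<le> real (card (Lin n K)) * exp (- (1 - 2 * \<epsilon>)\<^sup>2 * 2 ^ n / 2)"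
      unfolding E_def by (rule prob_not_far[OF \<epsilon> finite_Lin])
    also have "\<dots> \<le> 2 ^ n * exp (- (1 - 2 * \<epsilon>)\<^sup>2 * 2 ^ n / 2)"
    proof (rule mult_right_mono)
      have "card (Lin n K) \<le> 2 ^ n" using card_Lin_le binomial_le_pow2 by (rule order.trans)
      then have "real (card (Lin n K)) \<le> real (2 ^ n)" by (simp only: of_nat_le_iff)
      then show "real (card (Lin n K)) \<le> 2 ^ n" by simp
    qed simp
    also have "\<dots> \<le> 1 / 10" by (rule far_whp)
    finally have "measure_pmf.prob E {f. \<not> far n \<epsilon> (Lin n K) f} \<le> 1 / 10" .
    moreover have "?far = space E - {f. \<not> far n \<epsilon> (Lin n K) f}" by auto
    then have "measure_pmf.prob E ?far = 1 - measure_pmf.prob E {f. \<not> far n \<epsilon> (Lin n K) f}"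
      by (simp only: measure_pmf.prob_compl sets_measure_pmf UNIV_I)
    ultimately have "3 / 5 \<le> 2 / 3 * measure_pmf.prob E ?far" by simp
    also have "\<dots> = (\<integral>f. 2 / 3 * indicator ?far f \<partial>E)" by simp
    also have "\<dots> \<le> measure_pmf.expectation E ?rej"
    proof (rule integral_mono_AE)
      show "AE f in E. 2 / 3 * indicator ?far f \<le> ?rej f"
        using T by (auto simp: AE_measure_pmf_iff E_def is_tester_def indicator_def)
    qed (auto intro!: integrable_bounded_pmf[where b = 1] simp: indicator_def)
    finally show ?thesis .
  qed

  have G_bound: "\<bar>?G F U\<bar> \<le> 1" for F U
  proof -
    have "?G F U \<le> 1"
      by (rule measure_pmf.integral_le_const) (auto intro: integrable_bounded_pmf[where b = 1])
    moreover have "?G F U \<ge> 0" by (rule integral_nonneg_AE) auto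
    ultimately show ?thesis by simp
  qed
  \<comment> \<open>Subtracting the indicator makes the left side nonpositive on unbalanced samples,
    so one inequality covers all samples and can be integrated.\<close>
  have G: "9 / 10 * (?G E U - indicator ?bad U) \<le> ?G D U" if U: "U \<in> samples n u" for U
  proof (cases "balanced K (block m) l q U")
    case False
    have "?G E U \<le> 1" using G_bound[where F = E and U = U] by simp
    then have "9 / 10 * (?G E U - indicator ?bad U) \<le> 0" using False by simp
    also have "0 \<le> ?G D U" by (rule integral_nonneg_AE) simp
    finally show ?thesis .
  next
    case True
    have Un: "U \<subseteq> cube n" using U by (simp add: samples_def)
    have "9 / 10 * ?G E U = (\<integral>t. 9 / 10 * measure_pmf.prob E {f. \<not> accepts f t} \<partial>A U)" by simp
    also have "\<dots> \<le> ?G D U"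
    proof (rule integral_mono_AE)
      have "9 / 10 * measure_pmf.prob E {f. accepts f t = False} \<le> measure_pmf.prob D {f. accepts f t = False}"
        if "t \<in> set_pmf (A U)" for t
      proof (rule dominated_strategy)
        show "queried t \<subseteq> U" "query_count t \<le> q"
          using T U that by (auto simp: is_tester_def)
        fix Q y assume Q: "Q \<subseteq> U" "card Q \<le> q"
        have "balanced K (block m) l q Q" using True Q(1) unfolding balanced_def by blast
        then have "9 / 10 / 2 ^ card Q \<le> measure_pmf.prob D {f. \<forall>x\<in>Q. f x = y x}"
          unfolding D_def using Q Un by (intro block_parity_match[OF _ _ _ m(1) l near_uniform]) auto
        moreover have "measure_pmf.prob E {f. \<forall>x\<in>Q. f x = y x} = 1 / 2 ^ card Q"
          unfolding E_def using Q Un by (intro prob_uniform_function_match) auto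
        ultimately show "9 / 10 * measure_pmf.prob E {f. \<forall>x\<in>Q. f x = y x}
            \<le> measure_pmf.prob D {f. \<forall>x\<in>Q. f x = y x}" by simp
      qed
      then show "AE t in A U. 9 / 10 * measure_pmf.prob E {f. \<not> accepts f t} \<le> measure_pmf.prob D {f. \<not> accepts f t}"
        by (simp add: AE_measure_pmf_iff)
      show "integrable (A U) (\<lambda>t. 9 / 10 * measure_pmf.prob E {f. \<not> accepts f t})"
        by (intro integrable_mult_right integrable_bounded_pmf[where b = 1]) simp
    qed (rule integrable_bounded_pmf[where b = 1], simp)
    finally show ?thesis using True by simp
  qed

  have int: "integrable ?S (?G F)" for F
    by (rule integrable_bounded_pmf[where b = 1]) (rule G_bound)
  have int': "integrable ?S (indicator ?bad :: _ \<Rightarrow> real)"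
    by (rule integrable_bounded_pmf[where b = 1]) (simp add: indicator_def)
  have "9 / 10 * (measure_pmf.expectation E ?rej - measure_pmf.prob ?S ?bad)
      = (\<integral>U. 9 / 10 * (?G E U - indicator ?bad U) \<partial>?S)"
    using int[of E] int' by (simp add: prob_rejects_swap Bochner_Integration.integral_diff)
  also have "\<dots> \<le> (\<integral>U. ?G D U \<partial>?S)"
  proof (rule integral_mono_AE)
    show "AE U in ?S. 9 / 10 * (?G E U - indicator ?bad U) \<le> ?G D U"
      using G by (simp only: AE_measure_pmf_iff setS) blast
  qed (use int[of E] int[of D] int' in auto)
  also have "\<dots> \<le> 1 / 3" using D by (simp add: prob_rejects_swap)
  finally show False using bad E by simp
qed

subsection \<open>Asymptotics\<close>

lemma min_or_0_bounds:
  assumes "q \<in> S"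
  shows "min_or_0 S \<in> S" "min_or_0 S \<le> q"
  using assms by (auto simp: min_or_0_def intro: LeastI Least_le)

lemma Lin_tester_exists:
  assumes \<epsilon>: "0 < \<epsilon>" "\<epsilon> < 1 / 2" and n: "2 \<le> n" and K: "1 \<le> K"
    and room: "(3 / \<epsilon> + 1) * (real K * log 2 (real n)) \<le> 2 ^ n"
  shows "\<exists>q A. is_tester n (Lin n K) \<epsilon> q q A \<and> real q \<le> (3 / \<epsilon> + 1) * (real K * log 2 (real n))"
proof -
  let ?L = "log 2 (real n)"
  \<comment> \<open>Chosen so that \<open>(1 - \<epsilon>) ^ q \<le> exp (- \<epsilon> * q)\<close>
    beats the at most \<open>n ^ K = exp (K * ln n)\<close> candidates by a factor
    \<open>exp (- 2)\<close>, which is below 1/3.\<close>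
  define q where "q = nat \<lceil>(real K * ln (real n) + 2) / \<epsilon>\<rceil>"
  have n0: "0 < real n" "1 \<le> real n" using n by auto
  have L1: "1 \<le> ?L" using n by (simp add: le_log_iff)
  have "1 * 1 \<le> real K * ?L" using K L1 by (intro mult_mono) auto
  then have KL: "1 \<le> real K * ?L" by simp
  have lnL: "ln (real n) \<le> ?L"
  proof -
    have "ln (real n) = ?L * ln 2" by (simp add: log_def)
    also have "\<dots> \<le> ?L * 1" using L1 ln_2_less_1 by (intro mult_left_mono) auto
    finally show ?thesis by simp
  qed
  have nonneg: "0 \<le> (real K * ln (real n) + 2) / \<epsilon>" using \<epsilon> n0 by simp
  have q_ge: "(real K * ln (real n) + 2) / \<epsilon> \<le> real q"
    unfolding q_def by (rule real_nat_ceiling_ge)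
  have "real q \<le> (real K * ln (real n) + 2) / \<epsilon> + 1"
    unfolding q_def using nonneg by linarith
  \<comment> \<open>The additive 2 and the 1 from rounding up are absorbed using
    \<open>real K * ?L \<ge> 1\<close>.\<close>
  also have "\<dots> \<le> (real K * ?L + 2 * (real K * ?L)) / \<epsilon> + real K * ?L"
    using \<epsilon> KL lnL by (intro add_mono divide_right_mono mult_left_mono) auto
  also have "\<dots> = (3 / \<epsilon> + 1) * (real K * ?L)" by (simp add: algebra_simps)
  finally have q_le: "real q \<le> (3 / \<epsilon> + 1) * (real K * ?L)" .
  then have "real q \<le> 2 ^ n" using room by (rule order.trans)
  then have q2: "q \<le> 2 ^ n" by simp
  have "card (Lin n K) \<le> n ^ K"
    using card_Lin_le[of n K] binomial_le_pow[of K n] by (cases "K \<le> n") (auto simp: binomial_eq_0)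
  then have "real (card (Lin n K)) \<le> real (n ^ K)" by (simp only: of_nat_le_iff)
  also have "\<dots> = exp (real K * ln (real n))" using n0 by (simp add: exp_of_nat_mult)
  finally have card: "real (card (Lin n K)) \<le> exp (real K * ln (real n))" .
  have "(1 - \<epsilon>) ^ q \<le> exp (- \<epsilon>) ^ q"
    using \<epsilon> exp_ge_add_one_self[of "- \<epsilon>"] by (intro power_mono) auto
  also have "\<dots> = exp (- (\<epsilon> * real q))" by (simp add: mult.commute flip: exp_of_nat_mult)
  also have "\<dots> \<le> exp (- (real K * ln (real n) + 2))"
    using q_ge \<epsilon> by (simp add: divide_le_eq mult.commute)
  finally have pow: "(1 - \<epsilon>) ^ q \<le> exp (- (real K * ln (real n) + 2))" .
  have "real (card (Lin n K)) * (1 - \<epsilon>) ^ q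
      \<le> exp (real K * ln (real n)) * exp (- (real K * ln (real n) + 2))"
    using \<epsilon> by (intro mult_mono card pow) auto
  also have "\<dots> = exp (- 2)" by (simp flip: exp_add)
  also have "\<dots> \<le> 1 / 3"
    using exp_ge_add_one_self[of "2 :: real"] by (simp add: exp_minus field_simps)
  finally show ?thesis
    using consistency_tester[OF q2 finite_Lin] q_le by blast
qed

text \<open>The threshold for \<open>n\<close> is uniform in \<open>u\<close>, \<open>q\<close> and
  \<open>A\<close>, so that these may later depend on \<open>n\<close>.\<close>

lemma Lin_query_lower_bound:
  fixes k :: "nat \<Rightarrow> nat"
  assumes \<epsilon>: "\<epsilon> < 1 / 2" and k1: "\<forall>\<^sub>F n in sequentially. 1 \<le> k n"
    and k: "\<forall>\<^sub>F n in sequentially. real (k n) \<le> c * log 2 (real n)" and c: "0 < c" and b: "0 < b"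
  shows "\<forall>\<^sub>F n in sequentially. \<forall>u q A. 0 < u \<longrightarrow> real u \<le> real n powr b \<longrightarrow>
    is_tester n (Lin n (k n)) \<epsilon> u q A \<longrightarrow> real (k n) * log 2 (real n) / 16 \<le> real q"
proof -
  \<comment> \<open>Ensures that the block size \<open>n div k n\<close> is at least the square root
    of \<open>n\<close>; the summand 1 pays for rounding down.\<close>
  have e1: "\<forall>\<^sub>F n in sequentially. c * log 2 (real n) * (real n powr (1 / 2) + 1) \<le> real n"
    using c by real_asymp
  \<comment> \<open>Unbalanced samples are rare: \<open>u ^ q\<close> is only \<open>exp\<close> of
    a polylogarithm, while the Hoeffding factor is
    \<open>exp (- (n powr (1 / 4)) / 2)\<close>.\<close>
  have e2: "\<forall>\<^sub>F n in sequentially. 2 * (c * log 2 (real n) * log 2 (real n)) * (c * log 2 (real n)) *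
      real n powr (b * (c * log 2 (real n) * log 2 (real n))) * exp (- (real n powr (1 / 4) / 2)) \<le> 1 / 10"
    using b c by real_asymp
  have e3: "\<forall>\<^sub>F n in sequentially. 10 \<le> real n powr (1 / 16)"
    by real_asymp
  define \<delta> where "\<delta> = (1 - 2 * \<epsilon>)\<^sup>2"
  have \<delta>: "0 < \<delta>" using \<epsilon> by (simp add: \<delta>_def)
  have e4: "\<forall>\<^sub>F n in sequentially. 2 ^ n * exp (- \<delta> * 2 ^ n / 2) \<le> (1 / 10 :: real)"
    using \<delta> by real_asymp
  show ?thesis
    using e1 e2 e3 e4 k1 k eventually_ge_at_top[of 2]
  proof eventually_elim
    case (elim n)
    show ?case
    proof (intro allI impI, rule ccontr)
      fix u q A
      assume u: "0 < u" "real u \<le> real n powr b" and T: "is_tester n (Lin n (k n)) \<epsilon> u q A"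
        and "\<not> real (k n) * log 2 (real n) / 16 \<le> real q"
      define x K L where "x = real n" and "K = k n" and "L = log 2 x"
      define m where "m = n div K"
      define l where "l = real m powr (3 / 4)"
      have q: "real q < real K * L / 16" using \<open>\<not> _\<close> by (simp add: K_def L_def x_def)
      have x: "2 \<le> x" using elim by (simp add: x_def)
      have L: "1 \<le> L" using x by (simp add: L_def le_log_iff)
      have K: "1 \<le> K" "real K \<le> c * L" using elim by (auto simp: K_def L_def x_def)
      have q': "real q \<le> c * L * L"
      proof -
        have "0 \<le> real K * L" using L by simp
        then have "real q \<le> real K * L" using q by linarith
        also have "\<dots> \<le> c * L * L" using K L by (intro mult_right_mono) auto
        finally show ?thesis .
      qed
      have m_ge: "x powr (1 / 2) \<le> real m"
      proof -
        have "n < (m + 1) * K" using K dividend_less_times_div[of K n] by (simp add: m_def algebra_simps)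
        then have "x < real ((m + 1) * K)" unfolding x_def by (simp only: of_nat_less_iff)
        moreover have "real K * (x powr (1 / 2) + 1) \<le> c * L * (x powr (1 / 2) + 1)"
          using K by (intro mult_right_mono) auto
        moreover have "\<dots> \<le> x" using elim(1) by (simp add: L_def x_def)
        ultimately have "real K * (x powr (1 / 2) + 1) < real K * (real m + 1)"
          by (simp add: algebra_simps)
        then show ?thesis using K by simp
      qed
      have m: "0 < m"
      proof -
        have "0 < x powr (1 / 2)" using x by simp
        then show ?thesis using m_ge by linarith
      qed
      \<comment> \<open>With \<open>l = m powr (3 / 4)\<close> the Hoeffding exponent becomes half
        the square root of \<open>m\<close>.\<close>
      have "l\<^sup>2 = real m powr (3 / 2)"
        by (simp add: l_def power2_eq_square powr_add [symmetric])
      moreover have "real m powr (3 / 2) = real m * real m powr (1 / 2)"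
        using m powr_add[of "real m" 1 "1 / 2"] by simp
      ultimately have "l\<^sup>2 / (2 * m) = real m powr (1 / 2) / 2"
        using m by simp
      also have "real m powr (1 / 2) \<ge> (x powr (1 / 2)) powr (1 / 2)"
        using m_ge by (intro powr_mono2) auto
      then have "real m powr (1 / 2) / 2 \<ge> x powr (1 / 4) / 2" by (simp only: powr_powr) simp
      finally have l: "x powr (1 / 4) / 2 \<le> l\<^sup>2 / (2 * m)" .

      have "2 * real q * real K * real u ^ q * exp (- l\<^sup>2 / (2 * m))
          \<le> 2 * (c * L * L) * (c * L) * x powr (b * (c * L * L)) * exp (- (x powr (1 / 4) / 2))"
      proof (intro mult_mono)
        have "real u ^ q \<le> (x powr b) ^ q" using u by (intro power_mono) (auto simp: x_def)
        also have "\<dots> = x powr (b * real q)"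
          using x powr_realpow[of "x powr b" q] powr_powr[of x b "real q"] by simp
        also have "\<dots> \<le> x powr (b * (c * L * L))"
          using x q' b by (intro powr_mono mult_left_mono) auto
        finally show "real u ^ q \<le> x powr (b * (c * L * L))" .
      qed (use q' K l c L in auto)
      also have "\<dots> \<le> 1 / 10" using elim(2) by (simp add: L_def x_def)
      finally have balanced_whp: "2 * real q * real K * real u ^ q * exp (- l\<^sup>2 / (2 * m)) \<le> 1 / 10" .

      have near_uniform: "10 * 2 ^ q * l ^ K \<le> real m ^ K"
      proof -
        \<comment> \<open>Origin of the constant 16: \<open>10 * 2 ^ q\<close> is at most
          \<open>x powr (1 / 16) * x powr (K / 16)\<close>, hence at most
          \<open>x powr (K / 8)\<close>, hence at most \<open>m powr (K / 4)\<close>, which is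
          exactly the gap between \<open>l ^ K\<close> and \<open>m ^ K\<close>.\<close>
        have "2 ^ q = 2 powr real q" by (simp add: powr_realpow)
        also have "\<dots> \<le> 2 powr (L * (real K / 16))" using q by (intro powr_mono) (auto simp: mult.commute)
        also have "\<dots> = x powr (real K / 16)"
          using x powr_powr[of 2 L "real K / 16"] by (simp add: L_def)
        finally have "10 * 2 ^ q \<le> x powr (1 / 16) * x powr (real K / 16)"
          using elim(3) x by (intro mult_mono) (auto simp: x_def)
        also have "\<dots> \<le> x powr (real K / 16) * x powr (real K / 16)"
          using x K by (intro mult_right_mono powr_mono) auto
        also have "\<dots> = (x powr (1 / 2)) powr (real K / 4)"
          by (simp add: powr_powr powr_add [symmetric])
        also have "\<dots> \<le> real m powr (real K / 4)"
          using m_ge by (intro powr_mono2) auto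
        finally have "10 * 2 ^ q * l ^ K \<le> real m powr (real K / 4) * l ^ K"
          by (intro mult_right_mono) (auto simp: l_def)
        also have "\<dots> = real m powr (real K / 4) * real m powr (3 / 4 * real K)"
          using m powr_realpow[of l K] by (simp add: l_def powr_powr)
        also have "\<dots> = real m powr real K"
          by (simp add: powr_add [symmetric])
        also have "\<dots> = real m ^ K" using m by (simp add: powr_realpow)
        finally show ?thesis .
      qed
      have "K * m \<le> n" by (simp add: m_def)
      moreover have "2 ^ n * exp (- (1 - 2 * \<epsilon>)\<^sup>2 * 2 ^ n / 2) \<le> 1 / 10"
        using elim(4) by (simp add: \<delta>_def)
      moreover have "0 \<le> l" by (simp add: l_def)
      ultimately show False
        using tester_query_lower_bound[OF T[folded K_def] \<epsilon> u(1) m _ _ balanced_whp near_uniform] by blast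
    qed
  qed
qed

theorem theorem7:
  fixes \<epsilon> :: real and k u :: "nat \<Rightarrow> nat"
  assumes "0 < \<epsilon>" and "\<epsilon> < 1 / 2"
    and "\<forall>\<^sub>F n in sequentially. 1 \<le> k n"
    and "(\<lambda>n. real (k n)) \<in> O(\<lambda>n. log 2 (real n) / log 2 (log 2 (real n)))"
    and "poly_size u"
  shows
    "(\<lambda>n. real (Q_active \<epsilon> n (Lin n (k n)) (u n))) \<in> \<Theta>(\<lambda>n. real (k n) * log 2 (real n)) \<and>
    (\<lambda>n. real (Q_passive \<epsilon> n (Lin n (k n)))) \<in> \<Theta>(\<lambda>n. real (k n) * log 2 (real n))"
proof -
  have "(\<lambda>n. log 2 (real n) / log 2 (log 2 (real n))) \<in> O(\<lambda>n. log 2 (real n))"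
    by real_asymp
  with assms(4) have "(\<lambda>n. real (k n)) \<in> O(\<lambda>n. log 2 (real n))"
    by (rule landau_o.big_trans)
  then obtain c where c: "0 < c" and kc: "\<forall>\<^sub>F n in sequentially. norm (real (k n)) \<le> c * norm (log 2 (real n))"
    by (rule landau_o.bigE)
  have k: "\<forall>\<^sub>F n in sequentially. real (k n) \<le> c * log 2 (real n)"
    using kc eventually_ge_at_top[of 2] by eventually_elim simp
  obtain a b0 where a: "0 < a" and u: "\<forall>\<^sub>F n in sequentially. real n powr a \<le> real (u n) \<and> real (u n) \<le> real n powr b0"
    using assms(5) unfolding poly_size_def by blast
  \<comment> \<open>The maximum with 1 makes the lower bound apply to samples of size
    \<open>n\<close> as well.\<close>
  define b where "b = max 1 b0"
  define C where "C = 3 / \<epsilon> + 1"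
  have C: "0 < C" using assms(1) by (simp add: C_def add_pos_pos)
  have b: "1 \<le> b" "b0 \<le> b" by (simp_all add: b_def)
  have lower: "\<forall>\<^sub>F n in sequentially. \<forall>u q A. 0 < u \<longrightarrow> real u \<le> real n powr b \<longrightarrow>
      is_tester n (Lin n (k n)) \<epsilon> u q A \<longrightarrow> real (k n) * log 2 (real n) / 16 \<le> real q"
    using Lin_query_lower_bound[OF assms(2,3) k c, of b] b by simp
  \<comment> \<open>This and the next estimate make the query number of the consistency tester fit
    into \<open>u n\<close> and into \<open>n\<close> points.\<close>
  have small_a: "\<forall>\<^sub>F n in sequentially. C * (c * log 2 (real n) * log 2 (real n)) \<le> real n powr a"
    using C c a by real_asymp
  have small_1: "\<forall>\<^sub>F n in sequentially. C * (c * log 2 (real n) * log 2 (real n)) \<le> real n"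
    using C c by real_asymp
  have large: "\<forall>\<^sub>F n in sequentially. real n powr b \<le> 2 ^ n"
    by real_asymp
  have main: "\<forall>\<^sub>F n in sequentially.
      (real (k n) * log 2 (real n) / 16 \<le> real (Q_active \<epsilon> n (Lin n (k n)) (u n)) \<and>
       real (Q_active \<epsilon> n (Lin n (k n)) (u n)) \<le> C * (real (k n) * log 2 (real n))) \<and>
      (real (k n) * log 2 (real n) / 16 \<le> real (Q_passive \<epsilon> n (Lin n (k n))) \<and>
       real (Q_passive \<epsilon> n (Lin n (k n))) \<le> C * (real (k n) * log 2 (real n)))"
    using k u lower small_a small_1 large assms(3) eventually_ge_at_top[of 2]
  proof eventually_elim
    case (elim n)
    let ?P = "Lin n (k n)" and ?KL = "real (k n) * log 2 (real n)"
    have n: "2 \<le> n" "1 \<le> real n" using elim by auto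
    have L: "1 \<le> log 2 (real n)" using n by (simp add: le_log_iff)
    have "?KL \<le> c * log 2 (real n) * log 2 (real n)"
      using elim(1) L by (intro mult_right_mono) auto
    then have CKL: "C * ?KL \<le> C * (c * log 2 (real n) * log 2 (real n))"
      using C by (intro mult_left_mono) auto
    have un: "real (u n) \<le> real n powr b"
      using elim(2) powr_mono[OF b(2) n(2)] by linarith
    have n_le: "real n \<le> real n powr b"
      using powr_mono[OF b(1) n(2)] n by simp
    have u2: "u n \<le> 2 ^ n" "n \<le> 2 ^ n"
    proof -
      have "real (u n) \<le> 2 ^ n" using un elim(6) by (rule order.trans)
      then show "u n \<le> 2 ^ n" by simp
    qed simp
    have "C * ?KL \<le> 2 ^ n" using CKL elim(5,6) n_le by linarith
    then obtain q A where A: "is_tester n ?P \<epsilon> q q A" and q: "real q \<le> C * ?KL"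
      using Lin_tester_exists[OF assms(1,2) n(1) elim(7)] unfolding C_def by blast
    have qu: "q \<le> u n" using q CKL elim(2,4) by linarith
    have qn: "q \<le> n" using q CKL elim(5) by linarith
    let ?Sa = "{q. \<exists>A. is_tester n ?P \<epsilon> (u n) q A}" and ?Sp = "{q. \<exists>A. is_tester n ?P \<epsilon> q q A}"
    have "q \<in> ?Sa" using is_tester_larger_sample[OF A qu u2(1)] by simp
    from min_or_0_bounds[OF this]
    have act: "Q_active \<epsilon> n ?P (u n) \<in> ?Sa" "Q_active \<epsilon> n ?P (u n) \<le> q"
      unfolding Q_active_def by auto
    have "q \<in> ?Sp" using A by blast
    from min_or_0_bounds[OF this]
    have pas: "Q_passive \<epsilon> n ?P \<in> ?Sp" "Q_passive \<epsilon> n ?P \<le> q"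
      unfolding Q_passive_def by auto
    have "0 < real n powr a" using n by simp
    then have u0: "0 < u n" using elim(2) by linarith
    have "?KL / 16 \<le> real (Q_active \<epsilon> n ?P (u n))"
    proof -
      obtain B where "is_tester n ?P \<epsilon> (u n) (Q_active \<epsilon> n ?P (u n)) B" using act(1) by blast
      then show ?thesis using elim(3)[rule_format, OF u0 un] by simp
    qed
    moreover have "?KL / 16 \<le> real (Q_passive \<epsilon> n ?P)"
    proof -
      obtain B where "is_tester n ?P \<epsilon> (Q_passive \<epsilon> n ?P) (Q_passive \<epsilon> n ?P) B" using pas(1) by blast
      then obtain B' where "is_tester n ?P \<epsilon> n (Q_passive \<epsilon> n ?P) B'"
        using is_tester_larger_sample[OF _ order.trans[OF pas(2) qn] u2(2)] by blast
      moreover have "0 < n" using n by simp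
      ultimately show ?thesis using elim(3)[rule_format, OF _ n_le] by simp
    qed
    moreover have "real (Q_active \<epsilon> n ?P (u n)) \<le> C * ?KL" "real (Q_passive \<epsilon> n ?P) \<le> C * ?KL"
      using act(2) pas(2) q by linarith+
    ultimately show ?case by blast
  qed
  have \<Theta>: "f \<in> \<Theta>(\<lambda>n. real (k n) * log 2 (real n))"
    if "\<forall>\<^sub>F n in sequentially. real (k n) * log 2 (real n) / 16 \<le> f n \<and> f n \<le> C * (real (k n) * log 2 (real n))"
    for f :: "nat \<Rightarrow> real"
  proof (rule bigthetaI)
    have pos: "\<forall>\<^sub>F n in sequentially. 0 \<le> real (k n) * log 2 (real n)"
      using eventually_ge_at_top[of 2] by eventually_elim simp
    have "\<forall>\<^sub>F n in sequentially. norm (f n) \<le> C * norm (real (k n) * log 2 (real n))"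
      using that pos by eventually_elim (simp only: real_norm_def, linarith)
    then show "f \<in> O(\<lambda>n. real (k n) * log 2 (real n))" by (rule landau_o.bigI[OF C])
    have "\<forall>\<^sub>F n in sequentially. norm (f n) \<ge> 1 / 16 * norm (real (k n) * log 2 (real n))"
      using that pos by eventually_elim (simp only: real_norm_def, linarith)
    then show "f \<in> \<Omega>(\<lambda>n. real (k n) * log 2 (real n))" by (intro landau_omega.bigI[of "1 / 16"]) simp_all
  qed
  show ?thesis
    using main by (intro conjI \<Theta>) (simp_all add: eventually_conj_iff)
qed

end
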